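(* Let $N\ge 2$. Put $k=\frac{(N-1)(N-2)}{2}$ and $l=N-1$. Assume that the following holds: for every $SO(N)$-admissible function $f:[-1,1]^{k}\times (S^1)^{l}\to\mathbb{C}$, if $$\int_{[-1,1]^{k}}\int_{(S^1)^{l}} f(x,z)^P\, J_{SO(N)}(x)\,\frac{dz_1}{z_1}\cdots\frac{dz_l}{z_l}\,dx_1\cdots dx_k=0\qquad\text{for all } P\in\mathbb{N},$$ then $\vec 0\in\mathbb{R}^l$ does not lie in the convex hull of $\mathrm{Sp}(f)$. Then Mathieu's conjecture is true for $SO(N)$; that is, for all finite-type functions $f,h:SO(N)\to\mathbb{C}$ such that $\int_{SO(N)} f^P\,dg=0$ for all $P\in\mathbb{N}$, one has $\int_{SO(N)} f^P h\,dg=0$ for all sufficiently large $P$.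
   Context: $\mathbb{N}=\{1,2,3,\dots\}$, and $dg$ is the Haar measure on $SO(N)$. $S^1\subset\mathbb{C}$ is the unit circle, and integrals over $S^1$ are taken counterclockwise. For $N=2$ there are no $x$-variables ($k=0$). **Finite-type functions.** For a compact Lie group $G$, a function $f:G\to\mathbb{C}$ is a finite-type function if it is a finite sum of matrix components of irreducible continuous representations, i.e. $f(x)=\sum_{j=1}^M \mathrm{Tr}[a_j\pi_j(x)]$ with $(\pi_j,V_j)$ irreducible continuous (finite-dimensional complex) representations of $G$ and $a_j\in\mathrm{End}(V_j)$. **$SO(N)$-admissible functions.** A function $f:[-1,1]^k\times(S^1)^l\to\mathbb{C}$ is $SO(N)$-admissible if it can be written as a finite sum $$f(x_1,\dots,x_k,z_1,\dots,z_l)=\sum_{\vec m}c_{\vec m}(x)z^{\vec m},\qquad z^{\vec m}=z_1^{m_1}\cdots z_l^{m_l},$$ where $\vec m=(m_1,\dots,m_l)\in\mathbb{Z}^l$ and each $c_{\vec m}(x)\in\mathbb{C}[x_1,(1-x_1^2)^{1/2},\dots,x_k,(1-x_k^2)^{1/2}]$ is a complex polynomial in the $x_i$ and $\sqrt{1-x_i^2}$. The spectrum $\mathrm{Sp}(f)$ is the set of $\vec m$ for which $c_{\vec m}\neq 0$. **The weight $J_{SO(N)}$.** It is defined recursively by $J_{SO(2)}\equiv 1$ and, for $3\le n\le N$, $$J_{SO(n)}\big(x_1,\dots,x_{\frac{(n-1)(n-2)}{2}}\big):=C_n\Big(\prod_{j=1}^{n-2}(1-x_j^2)^{\frac{j-1}{2}}\Big)J_{SO(n-1)}\big(x_{n-1},\dots,x_{\frac{(n-1)(n-2)}{2}}\big),$$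 where $C_n:=\frac{1}{2\pi^{n/2}}\Gamma\!\left(\frac n2\right)$ and $\Gamma$ is the Euler Gamma function. *)

theory Defs
  imports
    "HOL-Complex_Analysis.Contour_Integration"
    "HOL-Library.Function_Algebras"
    "Jordan_Normal_Form.Matrix"
begin

text \<open>
  Compact Lie groups are taken as matrix groups \<open>G\<close> of real matrices indexed by a finite type
  \<open>'n\<close>; the group \<open>SO(N)\<close> is \<open>SO\<close> with \<open>CARD('n) = N\<close>.
\<close>

definition SO :: "(real^'n^'n) set" where
  "SO = {A. rotation_matrix A}"

text \<open>
  The Haar measure of a compact group, normalised to total mass one; on a compact group
  left invariance implies right invariance and determines the measure.
\<close>

definition haar_measure_on :: "(real^'n^'n) set \<Rightarrow> (real^'n^'n) measure \<Rightarrow> bool" where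
  "haar_measure_on G \<mu> \<longleftrightarrow>
     sets \<mu> = sets (restrict_space borel G) \<and>
     emeasure \<mu> G = 1 \<and>
     (\<forall>g\<in>G. distr \<mu> \<mu> (\<lambda>x. g ** x) = \<mu>)"

text \<open>
  A finite-dimensional complex representation, after the choice of a basis of the space, is a
  homomorphism into the invertible \<open>d\<close> by \<open>d\<close> complex matrices (invertibility follows from the
  equations for the unit and the product). Here \<open>$$\<close> and \<open>1\<^sub>m\<close> belong to the matrices of
  variable dimension from \<open>Jordan_Normal_Form\<close>, and \<open>**\<close> and \<open>Finite_Cartesian_Product.mat 1\<close>
  to those of \<open>HOL-Analysis\<close>.
\<close>

definition continuous_rep ::
    "(real^'n^'n) set \<Rightarrow> nat \<Rightarrow> (real^'n^'n \<Rightarrow> complex mat) \<Rightarrow> bool" where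
  "continuous_rep G d \<pi> \<longleftrightarrow>
     (\<forall>x\<in>G. \<pi> x \<in> carrier_mat d d) \<and>
     \<pi> (Finite_Cartesian_Product.mat 1) = 1\<^sub>m d \<and>
     (\<forall>x\<in>G. \<forall>y\<in>G. \<pi> (x ** y) = \<pi> x * \<pi> y) \<and>
     (\<forall>i<d. \<forall>j<d. continuous_on G (\<lambda>x. \<pi> x $$ (i, j)))"

definition linear_subspace :: "nat \<Rightarrow> complex Matrix.vec set \<Rightarrow> bool" where
  "linear_subspace d W \<longleftrightarrow>
     W \<subseteq> carrier_vec d \<and> 0\<^sub>v d \<in> W \<and>
     (\<forall>v\<in>W. \<forall>w\<in>W. v + w \<in> W) \<and> (\<forall>c. \<forall>v\<in>W. c \<cdot>\<^sub>v v \<in> W)"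

definition irreducible_continuous_rep ::
    "(real^'n^'n) set \<Rightarrow> nat \<Rightarrow> (real^'n^'n \<Rightarrow> complex mat) \<Rightarrow> bool" where
  "irreducible_continuous_rep G d \<pi> \<longleftrightarrow>
     continuous_rep G d \<pi> \<and> d > 0 \<and>
     (\<forall>W. linear_subspace d W \<and> (\<forall>x\<in>G. \<forall>v\<in>W. \<pi> x *\<^sub>v v \<in> W) \<longrightarrow>
          W = {0\<^sub>v d} \<or> W = carrier_vec d)"

definition mat_trace :: "complex mat \<Rightarrow> complex" where
  "mat_trace A = (\<Sum>i<dim_row A. A $$ (i, i))"

definition finite_type :: "(real^'n^'n) set \<Rightarrow> (real^'n^'n \<Rightarrow> complex) \<Rightarrow> bool" where
  "finite_type G f \<longleftrightarrow>
     (\<exists>(M::nat) d \<pi> a.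
        (\<forall>j<M. irreducible_continuous_rep G (d j) (\<pi> j) \<and> a j \<in> carrier_mat (d j) (d j)) \<and>
        (\<forall>x\<in>G. f x = (\<Sum>j<M. mat_trace (a j * \<pi> j x))))"

text \<open>
  Points of \<open>[-1,1]\<^sup>k\<close> and \<open>(S\<^sup>1)\<^sup>l\<close> are functions on \<open>nat\<close> with coordinates \<open>1..k\<close> and \<open>1..l\<close>
  that are \<open>undefined\<close> elsewhere; for \<open>k = 0\<close> the cube is a single point.
\<close>

definition cube :: "nat \<Rightarrow> (nat \<Rightarrow> real) set" where
  "cube k = (\<Pi>\<^sub>E i\<in>{1..k}. {-1..1})"

definition torus :: "nat \<Rightarrow> (nat \<Rightarrow> complex) set" where
  "torus l = (\<Pi>\<^sub>E i\<in>{1..l}. sphere 0 1)"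

text \<open>
  The ring \<open>\<complex>[x\<^sub>1, (1 - x\<^sub>1\<^sup>2)\<^sup>1\<^sup>/\<^sup>2, \<dots>, x\<^sub>k, (1 - x\<^sub>k\<^sup>2)\<^sup>1\<^sup>/\<^sup>2]\<close>, as the algebra of functions generated by
  its generators. Only the values on \<open>cube k\<close> matter.
\<close>

inductive_set sqrt_polys :: "nat \<Rightarrow> ((nat \<Rightarrow> real) \<Rightarrow> complex) set" for k :: nat where
  const: "(\<lambda>x. a) \<in> sqrt_polys k"
| coord: "i \<in> {1..k} \<Longrightarrow> (\<lambda>x. complex_of_real (x i)) \<in> sqrt_polys k"
| root:  "i \<in> {1..k} \<Longrightarrow> (\<lambda>x. complex_of_real (sqrt (1 - (x i)\<^sup>2))) \<in> sqrt_polys k"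
| add:   "p \<in> sqrt_polys k \<Longrightarrow> q \<in> sqrt_polys k \<Longrightarrow> (\<lambda>x. p x + q x) \<in> sqrt_polys k"
| mult:  "p \<in> sqrt_polys k \<Longrightarrow> q \<in> sqrt_polys k \<Longrightarrow> (\<lambda>x. p x * q x) \<in> sqrt_polys k"

text \<open>Elements of \<open>\<int>\<^sup>l\<close> are functions vanishing outside \<open>{1..l}\<close>.\<close>

definition multi_indices :: "nat \<Rightarrow> (nat \<Rightarrow> int) set" where
  "multi_indices l = {m. \<forall>i. i \<notin> {1..l} \<longrightarrow> m i = 0}"

text \<open>\<open>f(x,z) = \<Sum>\<^bsub>m\<in>S\<^esub> c\<^sub>m(x) z\<^sup>m\<close> as in the definition of an admissible function.\<close>

definition admissible_expansion ::
    "nat \<Rightarrow> nat \<Rightarrow> ((nat \<Rightarrow> real) \<Rightarrow> (nat \<Rightarrow> complex) \<Rightarrow> complex) \<Rightarrow>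
     (nat \<Rightarrow> int) set \<Rightarrow> ((nat \<Rightarrow> int) \<Rightarrow> (nat \<Rightarrow> real) \<Rightarrow> complex) \<Rightarrow> bool" where
  "admissible_expansion k l f S c \<longleftrightarrow>
     finite S \<and> S \<subseteq> multi_indices l \<and> (\<forall>m\<in>S. c m \<in> sqrt_polys k) \<and>
     (\<forall>x\<in>cube k. \<forall>z\<in>torus l. f x z = (\<Sum>m\<in>S. c m x * (\<Prod>i=1..l. z i powi m i)))"

definition admissible ::
    "nat \<Rightarrow> nat \<Rightarrow> ((nat \<Rightarrow> real) \<Rightarrow> (nat \<Rightarrow> complex) \<Rightarrow> complex) \<Rightarrow> bool" where
  "admissible k l f \<longleftrightarrow> (\<exists>S c. admissible_expansion k l f S c)"

text \<open>
  The coefficients \<open>c m\<close> of \<open>f\<close> are determined on \<open>cube k\<close>, since the monomials \<open>z\<^sup>m\<close> are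
  linearly independent on \<open>torus l\<close>; so it does not matter which expansion is used.
\<close>

definition spectrum ::
    "nat \<Rightarrow> nat \<Rightarrow> ((nat \<Rightarrow> real) \<Rightarrow> (nat \<Rightarrow> complex) \<Rightarrow> complex) \<Rightarrow> (nat \<Rightarrow> int) set" where
  "spectrum k l f =
     {m. \<exists>S c. admissible_expansion k l f S c \<and> m \<in> S \<and> (\<exists>x\<in>cube k. c m x \<noteq> 0)}"

text \<open>
  Pointwise vector space structure, which makes \<open>convex hull\<close> available for sets of functions.
  The space \<open>\<real>\<^sup>l\<close> is the subspace of the functions in \<open>nat \<Rightarrow> real\<close> that vanish outside \<open>{1..l}\<close>.
\<close>

instantiation "fun" :: (type, real_vector) real_vector
begin

definition scaleR_fun :: "real \<Rightarrow> ('a \<Rightarrow> 'b) \<Rightarrow> 'a \<Rightarrow> 'b" where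
  "scaleR_fun r f = (\<lambda>x. r *\<^sub>R f x)"

instance
  by standard (simp_all add: scaleR_fun_def fun_eq_iff scaleR_add_right scaleR_add_left)

end

definition real_index :: "(nat \<Rightarrow> int) \<Rightarrow> nat \<Rightarrow> real" where
  "real_index m = (\<lambda>i. real_of_int (m i))"

text \<open>
  The factor \<open>(1 - x\<^sub>j\<^sup>2)\<^bsup>(j-1)/2\<^esup>\<close> is written as a natural power of the square root: unlike
  \<open>powr\<close>, this gives 1 for \<open>j = 1\<close> at the end points too.
\<close>

fun J_SO :: "nat \<Rightarrow> (nat \<Rightarrow> real) \<Rightarrow> real" where
  "J_SO n x =
     (if n \<le> 2 then 1
      else Gamma (real n / 2) / (2 * pi powr (real n / 2)) *
           (\<Prod>j=1..n-2. sqrt (1 - (x j)\<^sup>2) ^ (j - 1)) *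
           J_SO (n - 1) (\<lambda>i. x (i + (n - 2))))"

declare J_SO.simps [simp del]

text \<open>
  The iterated contour integral of \<open>F(z) dz\<^sub>1/z\<^sub>1 \<dots> dz\<^sub>l/z\<^sub>l\<close> over the counterclockwise unit
  circles; \<open>F\<close> is only evaluated at points of \<open>torus l\<close>.
\<close>

fun torus_integral :: "nat \<Rightarrow> ((nat \<Rightarrow> complex) \<Rightarrow> complex) \<Rightarrow> complex" where
  "torus_integral 0 F = F (\<lambda>_. undefined)"
| "torus_integral (Suc l) F =
     torus_integral l (\<lambda>z. contour_integral (circlepath 0 1) (\<lambda>w. F (z(Suc l := w)) / w))"

definition cube_measure :: "nat \<Rightarrow> (nat \<Rightarrow> real) measure" where
  "cube_measure k = (\<Pi>\<^sub>M i\<in>{1..k}. restrict_space lborel {-1..1})"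

end

theory Submission
  imports Defs "Jordan_Normal_Form.Determinant"
begin

text \<open>
  A rotation is a product of rotations in the planes of adjacent coordinates (generalised Euler
  angles). With \<open>z = e\<^sup>i\<^sup>\<phi>\<close> for the angles \<open>\<phi>\<close> in the first plane, and \<open>x = cos \<theta>\<close> for the other angles
  \<open>\<theta> \<in> [0, \<pi>]\<close>, Haar measure has a density proportional to \<open>J_SO\<close>, and a function of finite type becomes
  admissible. So if all integrals of powers of \<open>f\<close> vanish, the hypothesis says that 0 is not in the
  convex hull of the spectrum of \<open>f\<close> in these coordinates. By separation all exponents \<open>m\<close> satisfy
  \<open>\<langle>a, m\<rangle> \<ge> \<delta> > 0\<close> for some vector \<open>a\<close>. Those of \<open>f\<^sup>P\<close> then satisfy \<open>\<langle>a, m\<rangle> \<ge> P \<delta>\<close>, which for large \<open>P\<close>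
  outweighs the finitely many exponents of \<open>h\<close>: the function \<open>f\<^sup>P h\<close> has no constant term in \<open>z\<close>, and
  its integral over the torus is zero for every \<open>x\<close>.

  This rests on two facts about the rotation group.

  The first is that functions of finite type are polynomials in the matrix entries
  (\<open>representation_entries_polynomial\<close>). A continuous representation is uniformly close to a matrix
  of polynomials by the Stone-Weierstrass theorem; averaging this matrix against the representation
  gives the representation itself, up to an invertible constant matrix. As polynomials in
  sines and cosines of the angles, they are visibly admissible (\<open>admissible_matrix_poly\<close>).

  The second is that the weighted integral of a polynomial over the Euler angles is a fixed nonzero
  multiple of its Haar integral. It is an iterated average over rotations (\<open>euler_coordinates_integral\<close>), and it suffices that
  this average is invariant under rotations in adjacent planes: these generate the group
  (\<open>plane_invariant_constant_on_SO\<close>), so the average is a constant function, which Haar integration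
  identifies (\<open>euler_average_eq_haar\<close>). The invariance is proved by induction on the size of the
  block of angles (\<open>block_average_invariant\<close>). A rotation in one plane commutes with most of the
  others, and what is left is a statement about two angles on a 2-sphere
  (\<open>two_angle_average_invariant\<close>), an integration by parts.
\<close>

(* Matrices over a finite index type and matrices of variable dimension both occur; the short
   names and the subscript operator stay with the former. *)
no_notation vec_index (infixl "$" 100)
hide_const (open) Matrix.mat Determinant.det
hide_fact (open) Matrix.vec_eq_iff Matrix.mat_def

section \<open>Polynomial functions on matrices\<close>

text \<open>
  The complex polynomials in the matrix entries, generated inductively so that separation of
  variables, differentiability and admissibility are only checked on sums, products and entries.
\<close>

inductive_set matrix_polys :: "(real^'n^'n \<Rightarrow> complex) set" where
  const: "(\<lambda>M. c) \<in> matrix_polys"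
| entry: "(\<lambda>M. complex_of_real (M $ i $ j)) \<in> matrix_polys"
| add: "F \<in> matrix_polys \<Longrightarrow> H \<in> matrix_polys \<Longrightarrow> (\<lambda>M. F M + H M) \<in> matrix_polys"
| mult: "F \<in> matrix_polys \<Longrightarrow> H \<in> matrix_polys \<Longrightarrow> (\<lambda>M. F M * H M) \<in> matrix_polys"

lemma matrix_polys_sum:
  assumes "\<And>r. r \<in> I \<Longrightarrow> a r \<in> matrix_polys"
  shows "(\<lambda>M. \<Sum>r\<in>I. a r M) \<in> matrix_polys"
  using assms
  by (induction I rule: infinite_finite_induct) (auto intro: matrix_polys.intros)

lemma matrix_polys_power: "F \<in> matrix_polys \<Longrightarrow> (\<lambda>M. F M ^ n) \<in> matrix_polys"
  by (induction n) (auto intro: matrix_polys.intros)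

lemma sum_list_mult_product:
  fixes f :: "'a \<Rightarrow> 'c::comm_semiring_0" and g :: "'b \<Rightarrow> 'c"
  shows "(\<Sum>x\<leftarrow>xs. f x) * (\<Sum>y\<leftarrow>ys. g y) = (\<Sum>p\<leftarrow>List.product xs ys. f (fst p) * g (snd p))"
proof (induction xs)
  case (Cons x xs)
  have "(\<Sum>y\<leftarrow>ys. f x * g y) = f x * (\<Sum>y\<leftarrow>ys. g y)"
    by (rule sum_list_const_mult)
  with Cons show ?case
    by (simp add: distrib_right o_def)
qed simp

text \<open>
  A polynomial in the entries of a product splits into finitely many products of a polynomial in
  the left factor and one in the right factor. This is what allows linear functionals, such as
  Haar integration and averaging over rotations, to be applied to one factor at a time
  without any theorem on the exchange of integrals.
\<close>

lemma matrix_polys_separate: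
  fixes F :: "real^'n^'n \<Rightarrow> complex"
  assumes "F \<in> matrix_polys"
  obtains R :: nat and a b :: "nat \<Rightarrow> real^'n^'n \<Rightarrow> complex"
  where "\<And>r. r < R \<Longrightarrow> a r \<in> matrix_polys" "\<And>r. r < R \<Longrightarrow> b r \<in> matrix_polys"
    "\<And>A B. F (A ** B) = (\<Sum>r<R. a r A * b r B)"
proof -
  have "\<exists>ps. set ps \<subseteq> matrix_polys \<times> matrix_polys \<and>
      (\<forall>A B. F (A ** B) = (\<Sum>p\<leftarrow>ps. fst p A * snd p B))"
    using assms
  proof (induction F rule: matrix_polys.induct)
    case (const c)
    show ?case
      by (rule exI[of _ "[(\<lambda>M. c, \<lambda>M. 1)]"]) (auto intro: matrix_polys.const)
  next
    case (entry i j)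
    obtain ks :: "'n list" where ks: "distinct ks" "set ks = UNIV"
      using finite_distinct_list[OF finite] by blast
    show ?case
    proof (rule exI[of _ "map (\<lambda>k. (\<lambda>M. complex_of_real (M $ i $ k), \<lambda>M. complex_of_real (M $ k $ j))) ks"], intro conjI allI)
      fix A B :: "real^'n^'n"
      show "complex_of_real ((A ** B) $ i $ j) =
        (\<Sum>p\<leftarrow>map (\<lambda>k. (\<lambda>M. complex_of_real (M $ i $ k), \<lambda>M. complex_of_real (M $ k $ j))) ks. fst p A * snd p B)"
        by (simp add: o_def sum_list_distinct_conv_sum_set[OF ks(1)] ks(2) matrix_matrix_mult_def)
    qed (auto intro: matrix_polys.entry)
  next
    case (add F H)
    from add.IH(1) obtain ps where p:
      "set ps \<subseteq> matrix_polys \<times> matrix_polys" "\<And>A B. F (A ** B) = (\<Sum>p\<leftarrow>ps. fst p A * snd p B)"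
      by blast
    from add.IH(2) obtain qs where q:
      "set qs \<subseteq> matrix_polys \<times> matrix_polys" "\<And>A B. H (A ** B) = (\<Sum>p\<leftarrow>qs. fst p A * snd p B)"
      by blast
    show ?case using p q by (intro exI[of _ "ps @ qs"]) auto
  next
    case (mult F H)
    from mult.IH(1) obtain ps where p:
      "set ps \<subseteq> matrix_polys \<times> matrix_polys" "\<And>A B. F (A ** B) = (\<Sum>p\<leftarrow>ps. fst p A * snd p B)"
      by blast
    from mult.IH(2) obtain qs where q:
      "set qs \<subseteq> matrix_polys \<times> matrix_polys" "\<And>A B. H (A ** B) = (\<Sum>p\<leftarrow>qs. fst p A * snd p B)"
      by blast
    show ?case
    proof (rule exI[of _ "map (\<lambda>(p, q). (\<lambda>M. fst p M * fst q M, \<lambda>M. snd p M * snd q M)) (List.product ps qs)"], intro conjI allI)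
      show "set (map (\<lambda>(p, q). (\<lambda>M. fst p M * fst q M, \<lambda>M. snd p M * snd q M)) (List.product ps qs))
          \<subseteq> matrix_polys \<times> matrix_polys"
        using p(1) q(1) by (force intro: matrix_polys.mult)
    next
      fix A B :: "real^'n^'n"
      show "F (A ** B) * H (A ** B) = (\<Sum>p\<leftarrow>map (\<lambda>(p, q). (\<lambda>M. fst p M * fst q M, \<lambda>M. snd p M * snd q M)) (List.product ps qs). fst p A * snd p B)"
        unfolding p(2) q(2) sum_list_mult_product
        by (simp add: o_def case_prod_unfold mult_ac)
    qed
  qed
  then obtain ps where ps: "set ps \<subseteq> matrix_polys \<times> matrix_polys"
      "\<And>A B. F (A ** B) = (\<Sum>p\<leftarrow>ps. fst p A * snd p B)" by blast
  show thesis
  proof (rule that[of "length ps" "\<lambda>r. fst (ps ! r)" "\<lambda>r. snd (ps ! r)"])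
    fix r assume "r < length ps"
    then have "ps ! r \<in> matrix_polys \<times> matrix_polys" using ps(1) nth_mem by blast
    then show "fst (ps ! r) \<in> matrix_polys" "snd (ps ! r) \<in> matrix_polys" by auto
  next
    fix A B :: "real^'n^'n"
    show "F (A ** B) = (\<Sum>r<length ps. fst (ps ! r) A * snd (ps ! r) B)"
      unfolding ps(2) sum_list_sum_nth by (simp add: atLeast0LessThan)
  qed
qed


text \<open>
  Joint continuity of the derivative in the point and the direction is what the differentiation
  under the integral sign below asks for.
\<close>

lemma matrix_polys_has_derivative:
  fixes F :: "real^'n^'n \<Rightarrow> complex"
  assumes "F \<in> matrix_polys"
  obtains D where "\<And>M. (F has_derivative D M) (at M)"
    "continuous_on UNIV (\<lambda>p. D (fst p) (snd p))"
proof -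
  have "\<exists>D. (\<forall>M. (F has_derivative D M) (at M)) \<and> continuous_on UNIV (\<lambda>p. D (fst p) (snd p))"
    using assms
  proof (induction F rule: matrix_polys.induct)
    case (const c)
    show ?case by (rule exI[of _ "\<lambda>M V. 0"]) simp
  next
    case (entry i j)
    have bl: "bounded_linear (\<lambda>M::real^'n^'n. complex_of_real (M $ i $ j))"
      by (intro bounded_linear_compose[OF bounded_linear_of_real]
           bounded_linear_compose[OF bounded_linear_vec_nth] bounded_linear_vec_nth)
    show ?case
    proof (intro exI[of _ "\<lambda>M V. complex_of_real (V $ i $ j)"] conjI allI)
      show "continuous_on UNIV (\<lambda>p::(real^'n^'n) \<times> (real^'n^'n). complex_of_real (snd p $ i $ j))"
        by (rule bounded_linear.continuous_on[OF bl]) (rule continuous_on_snd[OF continuous_on_id])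
    qed (rule bounded_linear_imp_has_derivative[OF bl])
  next
    case (add F H)
    from add.IH(1) obtain D where D: "\<And>M. (F has_derivative D M) (at M)" "continuous_on UNIV (\<lambda>p. D (fst p) (snd p))"
      by blast
    from add.IH(2) obtain E where E: "\<And>M. (H has_derivative E M) (at M)" "continuous_on UNIV (\<lambda>p. E (fst p) (snd p))"
      by blast
    show ?case
      by (intro exI[of _ "\<lambda>M V. D M V + E M V"] conjI allI has_derivative_add D(1) E(1)
          continuous_on_add D(2) E(2))
  next
    case (mult F H)
    from mult.IH(1) obtain D where D: "\<And>M. (F has_derivative D M) (at M)" "continuous_on UNIV (\<lambda>p. D (fst p) (snd p))"
      by blast
    from mult.IH(2) obtain E where E: "\<And>M. (H has_derivative E M) (at M)" "continuous_on UNIV (\<lambda>p. E (fst p) (snd p))"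
      by blast
    have F: "continuous_on UNIV F" and H: "continuous_on UNIV H"
      by (auto intro!: continuous_at_imp_continuous_on has_derivative_continuous[OF D(1)]
          has_derivative_continuous[OF E(1)])
    have F': "continuous_on UNIV (\<lambda>p. F (fst p))" and H': "continuous_on UNIV (\<lambda>p. H (fst p))"
      by (rule continuous_on_compose2[OF F] continuous_on_compose2[OF H],
          rule continuous_on_fst[OF continuous_on_id], simp)+
    show ?case
      by (intro exI[of _ "\<lambda>M V. F M * E M V + D M V * H M"] conjI allI has_derivative_mult D(1) E(1)
          continuous_on_add continuous_on_mult D(2) E(2) F' H')
  qed
  with that show thesis by blast
qed

lemma matrix_polys_continuous_on:
  assumes "F \<in> matrix_polys"
  shows "continuous_on S F"
proof -
  obtain D where "\<And>M. (F has_derivative D M) (at M)"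
    using matrix_polys_has_derivative[OF assms] by metis
  then have "continuous (at M) F" for M by (rule has_derivative_continuous)
  then show ?thesis by (simp add: continuous_at_imp_continuous_on)
qed

lemma real_polynomial_imp_matrix_poly:
  fixes p :: "real^'n^'n \<Rightarrow> real"
  assumes "real_polynomial_function p"
  shows "(\<lambda>M. complex_of_real (p M)) \<in> matrix_polys"
  using assms
proof (induction p rule: real_polynomial_function.induct)
  case (linear f)
  then have lin: "linear f" by (simp add: bounded_linear.linear)
  have "f M = (\<Sum>i\<in>UNIV. \<Sum>j\<in>UNIV. M $ i $ j * f (axis i (axis j 1)))" for M :: "real^'n^'n"
  proof -
    have "M = (\<Sum>i\<in>UNIV. \<Sum>j\<in>UNIV. (M $ i $ j) *\<^sub>R axis i (axis j 1))"
    proof -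
      have "(\<Sum>i'\<in>UNIV. \<Sum>j'\<in>UNIV. (M $ i' $ j') * (axis i' (axis j' (1::real)) $ i $ j)) = M $ i $ j" for i j
      proof -
        have "(\<Sum>j'\<in>UNIV. (M $ i' $ j') * (axis i' (axis j' (1::real)) $ i $ j)) =
            (if i' = i then M $ i $ j else 0)" for i'
          by (cases "i' = i") (auto simp: axis_def if_distrib[of "\<lambda>x. _ * x"] if_distrib[of "\<lambda>x. x $ j"] cong: if_cong)
        then show ?thesis by simp
      qed
      then show ?thesis by (simp add: vec_eq_iff)
    qed
    then have "f M = f (\<Sum>i\<in>UNIV. \<Sum>j\<in>UNIV. (M $ i $ j) *\<^sub>R axis i (axis j 1))" by simp
    also have "\<dots> = (\<Sum>i\<in>UNIV. \<Sum>j\<in>UNIV. M $ i $ j * f (axis i (axis j 1)))"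
      by (simp add: linear_sum[OF lin] linear_cmul[OF lin])
    finally show ?thesis .
  qed
  then have "complex_of_real (f M) =
      (\<Sum>i\<in>UNIV. \<Sum>j\<in>UNIV. complex_of_real (M $ i $ j) * complex_of_real (f (axis i (axis j 1))))" for M
    by (metis (mono_tags, lifting) of_real_mult of_real_sum sum.cong)
  then have eq: "(\<lambda>M. complex_of_real (f M)) =
      (\<lambda>M. \<Sum>i\<in>UNIV. \<Sum>j\<in>UNIV. complex_of_real (M $ i $ j) * complex_of_real (f (axis i (axis j 1))))"
    by (rule ext)
  then show ?case
    by (subst eq) (intro matrix_polys_sum matrix_polys.mult matrix_polys.entry matrix_polys.const)
qed (auto intro: matrix_polys.intros)

lemma matrix_polys_dense:
  fixes f :: "real^'n^'n \<Rightarrow> complex"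
  assumes "compact S" "continuous_on S f" "e > 0"
  obtains F where "F \<in> matrix_polys" "\<And>M. M \<in> S \<Longrightarrow> cmod (F M - f M) < e"
proof -
  obtain p where p: "real_polynomial_function p" "\<And>M. M \<in> S \<Longrightarrow> \<bar>Re (f M) - p M\<bar> < e / 2"
    using Stone_Weierstrass_real_polynomial_function[of S "\<lambda>M. Re (f M)" "e / 2"] assms
    by (auto intro: continuous_intros)
  obtain q where q: "real_polynomial_function q" "\<And>M. M \<in> S \<Longrightarrow> \<bar>Im (f M) - q M\<bar> < e / 2"
    using Stone_Weierstrass_real_polynomial_function[of S "\<lambda>M. Im (f M)" "e / 2"] assms
    by (auto intro: continuous_intros)
  show thesis
  proof (rule that[of "\<lambda>M. complex_of_real (p M) + \<i> * complex_of_real (q M)"])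
    show "(\<lambda>M. complex_of_real (p M) + \<i> * complex_of_real (q M)) \<in> matrix_polys"
      by (intro matrix_polys.add matrix_polys.mult matrix_polys.const real_polynomial_imp_matrix_poly p q)
    fix M assume M: "M \<in> S"
    have "cmod (complex_of_real (p M) + \<i> * complex_of_real (q M) - f M) \<le>
        \<bar>p M - Re (f M)\<bar> + \<bar>q M - Im (f M)\<bar>"
      by (rule order_trans[OF cmod_le]) simp
    also have "\<dots> < e" using p(2)[OF M] q(2)[OF M] by (simp add: abs_minus_commute)
    finally show "cmod (complex_of_real (p M) + \<i> * complex_of_real (q M) - f M) < e" .
  qed
qed

section \<open>Rotations in coordinate planes\<close>

text \<open>
  Entries \<open>c\<close> and \<open>s\<close> are kept free instead of the cosine and sine of an angle, because in Euler
  coordinates they will be \<open>x\<close> and \<open>sqrt (1 - x\<^sup>2)\<close>, or the real and imaginary part of \<open>z\<close>.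
\<close>

definition givens :: "'n \<Rightarrow> 'n \<Rightarrow> real \<Rightarrow> real \<Rightarrow> real^'n^'n" where
  "givens a b c s = (\<chi> i j.
     if i = a then (if j = a then c else if j = b then - s else 0)
     else if i = b then (if j = a then s else if j = b then c else 0)
     else if i = j then 1 else 0)"

abbreviation rotation :: "'n \<Rightarrow> 'n \<Rightarrow> real \<Rightarrow> real^'n^'n" where
  "rotation a b t \<equiv> givens a b (cos t) (sin t)"

lemma givens_mult_row:
  assumes "a \<noteq> b"
  shows "(givens a b c s ** M) $ i =
    (if i = a then c *\<^sub>R M $ a - s *\<^sub>R M $ b
     else if i = b then s *\<^sub>R M $ a + c *\<^sub>R M $ b else M $ i)"
proof -
  have two: "(\<Sum>k\<in>UNIV. (if k = a then x else if k = b then y else 0) * M $ k $ j) = x * M $ a $ j + y * M $ b $ j"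
    for x y j
  proof -
    have "(\<Sum>k\<in>UNIV. (if k = a then x else if k = b then y else 0) * M $ k $ j) =
        (\<Sum>k\<in>UNIV. (if k = a then x * M $ a $ j else 0) + (if k = b then y * M $ b $ j else 0))"
      using assms by (intro sum.cong) auto
    then show ?thesis by (simp add: sum.distrib)
  qed
  have one: "(\<Sum>k\<in>UNIV. (if i = k then 1 else 0) * M $ k $ j) = M $ i $ j" for j
  proof -
    have "(\<Sum>k\<in>UNIV. (if i = k then 1 else 0) * M $ k $ j) = (\<Sum>k\<in>UNIV. if i = k then M $ k $ j else 0)"
      by (intro sum.cong) auto
    then show ?thesis by simp
  qed
  show ?thesis
    using assms two one
    by (auto simp: vec_eq_iff givens_def matrix_matrix_mult_def)
qed

text \<open>
  The infinitesimal generator of the rotations in the plane of \<open>a\<close> and \<open>b\<close>.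
\<close>

definition rot_gen :: "'n \<Rightarrow> 'n \<Rightarrow> real^'n^'n" where
  "rot_gen a b = givens a b 0 1 - givens a b 0 0"

lemma rot_gen_mult_row:
  assumes "a \<noteq> b"
  shows "(rot_gen a b ** M) $ i = (if i = a then - M $ b else if i = b then M $ a else 0)"
proof -
  have "rot_gen a b ** M = givens a b 0 1 ** M - givens a b 0 0 ** M"
    unfolding rot_gen_def
    by (simp add: vec_eq_iff matrix_matrix_mult_def sum_subtractf left_diff_distrib)
  then show ?thesis using assms by (simp add: givens_mult_row)
qed

lemma continuous_on_matrix_mult [continuous_intros]:
  fixes f g :: "'a::topological_space \<Rightarrow> real^'n^'n"
  assumes "continuous_on S f" "continuous_on S g"
  shows "continuous_on S (\<lambda>x. f x ** g x)"
  unfolding matrix_matrix_mult_def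
  by (intro continuous_intros assms)

lemma continuous_on_givens [continuous_intros]:
  assumes "continuous_on S c" "continuous_on S s"
  shows "continuous_on S (\<lambda>x. givens a b (c x) (s x))"
proof -
  have "continuous_on S (\<lambda>x. givens a b (c x) (s x) $ i $ j)" for i j
    using assms by (cases "i = a"; cases "i = b"; cases "j = a"; cases "j = b"; cases "i = j")
      (auto simp: givens_def intro!: continuous_intros)
  then have "continuous_on S (\<lambda>x. \<chi> i. \<chi> j. givens a b (c x) (s x) $ i $ j)"
    by (intro continuous_on_vec_lambda)
  then show ?thesis by simp
qed

lemma bounded_linear_matrix_mult_left:
  fixes A :: "real^'n^'n"
  shows "bounded_linear (\<lambda>M. A ** M :: real^'n^'n)"
proof -
  have "linear (\<lambda>M. A ** M :: real^'n^'n)"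
    by (rule linearI)
      (simp_all add: vec_eq_iff matrix_matrix_mult_def sum.distrib
        distrib_left sum_distrib_left mult_ac)
  then show ?thesis by (simp add: linear_conv_bounded_linear)
qed

text \<open>
  A rotated matrix depends on the angle as a constant plus fixed multiples of sine and cosine.
\<close>

lemma rotation_has_vector_derivative:
  assumes "a \<noteq> b"
  shows "((\<lambda>t. rotation a b t ** M) has_vector_derivative rot_gen a b ** (rotation a b t ** M)) (at t within S)"
proof -
  have dec: "rotation a b t ** M = givens a b 0 0 ** M
      + cos t *\<^sub>R (givens a b 1 0 ** M - givens a b 0 0 ** M) + sin t *\<^sub>R (rot_gen a b ** M)" for t
    using assms
    by (auto simp: vec_eq_iff givens_mult_row rot_gen_mult_row)
  have der: "rot_gen a b ** (rotation a b t ** M) =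
      - sin t *\<^sub>R (givens a b 1 0 ** M - givens a b 0 0 ** M) + cos t *\<^sub>R (rot_gen a b ** M)"
    using assms
    by (auto simp: vec_eq_iff givens_mult_row rot_gen_mult_row)
  show ?thesis
    unfolding der unfolding dec
    by (auto intro!: derivative_eq_intros)
qed

lemma rotation_0: "a \<noteq> b \<Longrightarrow> rotation a b 0 ** M = M"
  by (simp add: vec_eq_iff givens_mult_row)

lemma rotation_add: "a \<noteq> b \<Longrightarrow> rotation a b s ** (rotation a b t ** M) = rotation a b (s + t) ** M"
  by (auto simp: vec_eq_iff givens_mult_row cos_add sin_add algebra_simps)

lemma rotation_commute:
  assumes "a \<noteq> b" "c \<noteq> d" "{a, b} \<inter> {c, d} = {}"
  shows "rotation a b s ** (rotation c d t ** M) = rotation c d t ** (rotation a b s ** M)"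
  using assms by (auto simp: vec_eq_iff givens_mult_row)

text \<open>
  This identity in \<open>so(3)\<close> expresses the derivative in \<open>t\<close> of \<open>rotation b d \<beta> ** rotation a b \<alpha> ** rotation b d t\<close>
  through the derivatives in \<open>\<alpha>\<close> and \<open>\<beta>\<close> and an infinitesimal rotation in the plane of \<open>a\<close> and \<open>b\<close> from the left. The
  coefficients solve the linear system obtained by comparing the rows \<open>a\<close>, \<open>b\<close>, \<open>d\<close>; the factor
  \<open>sin \<beta>\<close> clears the singularity of the coordinates at the poles.
\<close>

lemma euler_angle_identity:
  assumes "a \<noteq> b" "b \<noteq> d" "a \<noteq> d"
  shows "sin \<beta> *\<^sub>R (rotation b d \<beta> ** (rotation a b \<alpha> ** (rot_gen b d ** N))) =
    - (sin \<alpha> * cos \<beta>) *\<^sub>R (rotation b d \<beta> ** (rot_gen a b ** (rotation a b \<alpha> ** N)))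
    + (sin \<beta> * cos \<alpha>) *\<^sub>R (rot_gen b d ** (rotation b d \<beta> ** (rotation a b \<alpha> ** N)))
    + sin \<alpha> *\<^sub>R (rot_gen a b ** (rotation b d \<beta> ** (rotation a b \<alpha> ** N)))"
proof -
  have trig: "sin \<alpha> * sin \<alpha> = 1 - cos \<alpha> * cos \<alpha>" "sin \<beta> * sin \<beta> = 1 - cos \<beta> * cos \<beta>"
    using sin_cos_squared_add[of \<alpha>] sin_cos_squared_add[of \<beta>]
    unfolding power2_eq_square by linarith+
  have "s * (s * x) = x - c * (c * x)" if "s * s = 1 - c * c" for s c x :: real
    by (simp add: that left_diff_distrib flip: mult.assoc)
  note trig = trig this[OF trig(1)] this[OF trig(2)]
  have "(sin \<beta> *\<^sub>R (rotation b d \<beta> ** (rotation a b \<alpha> ** (rot_gen b d ** N)))) $ i $ j =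
    (- (sin \<alpha> * cos \<beta>) *\<^sub>R (rotation b d \<beta> ** (rot_gen a b ** (rotation a b \<alpha> ** N)))
    + (sin \<beta> * cos \<alpha>) *\<^sub>R (rot_gen b d ** (rotation b d \<beta> ** (rotation a b \<alpha> ** N)))
    + sin \<alpha> *\<^sub>R (rot_gen a b ** (rotation b d \<beta> ** (rotation a b \<alpha> ** N)))) $ i $ j" for i j
  proof -
    consider "i = a" | "i = b" | "i = d" | "i \<notin> {a, b, d}" by auto
    then show ?thesis
    proof cases
      case 1
      then show ?thesis using assms assms[symmetric]
        by (simp add: givens_mult_row rot_gen_mult_row algebra_simps trig)
    next
      case 2
      then show ?thesis using assms assms[symmetric]
        by (simp add: givens_mult_row rot_gen_mult_row algebra_simps trig)
    next
      case 3
      then show ?thesis using assms assms[symmetric]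
        by (simp add: givens_mult_row rot_gen_mult_row algebra_simps trig)
    next
      case 4
      then show ?thesis using assms assms[symmetric]
        by (simp add: givens_mult_row rot_gen_mult_row)
    qed
  qed
  then show ?thesis unfolding vec_eq_iff by blast
qed


section \<open>Averaging over two consecutive rotation angles\<close>

lemma matrix_polys_invariant_derivative:
  assumes D: "\<And>M. (H has_derivative D M) (at M)" and "a \<noteq> b"
    and inv: "\<And>t M. H (rotation a b t ** M) = H M"
  shows "D Y (rot_gen a b ** Y) = (0::complex)"
proof -
  have "((\<lambda>t. rotation a b t ** Y) has_vector_derivative rot_gen a b ** (rotation a b 0 ** Y)) (at 0)"
    by (rule rotation_has_vector_derivative[OF \<open>a \<noteq> b\<close>])
  then have "((\<lambda>t. rotation a b t ** Y) has_vector_derivative rot_gen a b ** Y) (at 0)"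
    by (simp only: rotation_0[OF \<open>a \<noteq> b\<close>])
  moreover have "(H has_derivative D Y) (at (rotation a b 0 ** Y) within range (\<lambda>t. rotation a b t ** Y))"
    unfolding rotation_0[OF \<open>a \<noteq> b\<close>] by (rule has_derivative_at_withinI[OF D])
  ultimately have "((H \<circ> (\<lambda>t. rotation a b t ** Y)) has_vector_derivative D Y (rot_gen a b ** Y)) (at 0)"
    by (rule vector_derivative_diff_chain_within)
  moreover have "((H \<circ> (\<lambda>t. rotation a b t ** Y)) has_vector_derivative 0) (at 0)"
    by (simp add: o_def inv)
  ultimately show ?thesis by (rule vector_derivative_unique_at)
qed

lemma integral_deriv_zero:
  fixes f :: "real \<Rightarrow> complex"
  assumes "0 \<le> A" "\<And>x. (f has_vector_derivative f' x) (at x)" "f 0 = 0" "f A = 0"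
  shows "integral {0..A} f' = 0"
proof -
  have "(f' has_integral (f A - f 0)) {0..A}"
    by (rule fundamental_theorem_of_calculus) (auto intro: assms has_vector_derivative_at_within)
  then show ?thesis using assms by (simp add: integral_unique)
qed

text \<open>
  Geometrically, \<open>(\<alpha>, \<beta>)\<close> are spherical coordinates on a 2-sphere, \<open>sin \<alpha> ^ m * sin \<beta> ^ Suc m\<close> is
  the area element times the \<open>m\<close>-th power of the coordinate \<open>sin \<alpha> * sin \<beta>\<close>, and the rotation by \<open>t\<close>
  fixes this coordinate. The coordinates are singular at the poles, and invariance is therefore
  proved infinitesimally: in the derivative with respect to \<open>t\<close>, the identity above leaves the
  derivatives in \<open>\<alpha>\<close> and \<open>\<beta>\<close>, because \<open>H\<close> is constant along the remaining direction. Together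
  with the weight these form a divergence, whose integral vanishes as \<open>sin\<close> is zero at all end
  points. Both \<open>A = pi\<close> and \<open>A = 2 * pi\<close> occur below, the latter only with \<open>m = 0\<close>.
\<close>

lemma two_angle_average_invariant:
  fixes H :: "real^'n^'n \<Rightarrow> complex" and m :: nat and M :: "real^'n^'n"
  assumes H: "H \<in> matrix_polys" and dist: "a \<noteq> b" "b \<noteq> d" "a \<noteq> d"
    and inv: "\<And>t M. H (rotation a b t ** M) = H M"
    and A: "0 \<le> A" "sin A = 0"
  defines "K \<equiv> \<lambda>t. integral {0..A} (\<lambda>\<alpha>. complex_of_real (sin \<alpha> ^ m) * integral {0..pi} (\<lambda>\<beta>.
      complex_of_real (sin \<beta> ^ Suc m) * H (rotation b d \<beta> ** (rotation a b \<alpha> ** (rotation b d t ** M)))))"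
  shows "K t = K 0"
proof -
  obtain D where D: "\<And>M. (H has_derivative D M) (at M)"
    and contD: "continuous_on UNIV (\<lambda>p. D (fst p) (snd p))"
  proof (rule matrix_polys_has_derivative[OF H])
    fix D assume "\<And>M. (H has_derivative D M) (at M)" "continuous_on UNIV (\<lambda>p. D (fst p) (snd p))"
    then show thesis by (rule that)
  qed
  have contD': "continuous_on S (\<lambda>x. D (f x) (g x))" if "continuous_on S f" "continuous_on S g"
    for S :: "'b::t2_space set" and f g
    using continuous_on_compose2[OF contD continuous_on_Pair[OF that]] by simp
  have contH: "continuous_on S (\<lambda>x. H (f x))" if "continuous_on S f"
    for S :: "'b::t2_space set" and f
    by (rule continuous_on_compose2[OF matrix_polys_continuous_on[OF H] that subset_UNIV])
  have lin: "linear (D M)" for M using D has_derivative_linear by blast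
  note cont = contD' contH continuous_intros
  define Y where "Y = (\<lambda>t \<alpha> \<beta>. rotation b d \<beta> ** (rotation a b \<alpha> ** (rotation b d t ** M)))"
  define Yt where "Yt = (\<lambda>t \<alpha> \<beta>. rotation b d \<beta> ** (rotation a b \<alpha> ** (rot_gen b d ** (rotation b d t ** M))))"
  define Ya where "Ya = (\<lambda>t \<alpha> \<beta>. rotation b d \<beta> ** (rot_gen a b ** (rotation a b \<alpha> ** (rotation b d t ** M))))"
  define Yb where "Yb = (\<lambda>t \<alpha> \<beta>. rot_gen b d ** Y t \<alpha> \<beta>)"
  have chain: "((\<lambda>s. H (y s)) has_vector_derivative D (y s) y') (at s)"
    if "(y has_vector_derivative y') (at s)" for y y' s
    using vector_derivative_diff_chain_within[OF that has_derivative_at_withinI[OF D]] by (simp add: o_def)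
  have dt: "((\<lambda>t. H (Y t \<alpha> \<beta>)) has_vector_derivative D (Y t \<alpha> \<beta>) (Yt t \<alpha> \<beta>)) (at t)" for t \<alpha> \<beta>
    unfolding Y_def Yt_def
    by (intro chain bounded_linear.has_vector_derivative[OF bounded_linear_matrix_mult_left]
        rotation_has_vector_derivative dist)
  have da: "((\<lambda>\<alpha>. H (Y t \<alpha> \<beta>)) has_vector_derivative D (Y t \<alpha> \<beta>) (Ya t \<alpha> \<beta>)) (at \<alpha>)" for t \<alpha> \<beta>
    unfolding Y_def Ya_def
    by (intro chain bounded_linear.has_vector_derivative[OF bounded_linear_matrix_mult_left]
        rotation_has_vector_derivative dist)
  have db: "((\<lambda>\<beta>. H (Y t \<alpha> \<beta>)) has_vector_derivative D (Y t \<alpha> \<beta>) (Yb t \<alpha> \<beta>)) (at \<beta>)" for t \<alpha> \<beta>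
    unfolding Yb_def unfolding Y_def
    by (intro chain rotation_has_vector_derivative dist)
  have pde: "complex_of_real (sin \<beta>) * D (Y t \<alpha> \<beta>) (Yt t \<alpha> \<beta>) =
      - complex_of_real (sin \<alpha> * cos \<beta>) * D (Y t \<alpha> \<beta>) (Ya t \<alpha> \<beta>)
      + complex_of_real (sin \<beta> * cos \<alpha>) * D (Y t \<alpha> \<beta>) (Yb t \<alpha> \<beta>)" for t \<alpha> \<beta>
  proof -
    have "sin \<beta> *\<^sub>R Yt t \<alpha> \<beta> = - (sin \<alpha> * cos \<beta>) *\<^sub>R Ya t \<alpha> \<beta>
        + (sin \<beta> * cos \<alpha>) *\<^sub>R Yb t \<alpha> \<beta> + sin \<alpha> *\<^sub>R (rot_gen a b ** Y t \<alpha> \<beta>)"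
      unfolding Yt_def Ya_def Yb_def unfolding Y_def by (rule euler_angle_identity[OF dist])
    then have "D (Y t \<alpha> \<beta>) (sin \<beta> *\<^sub>R Yt t \<alpha> \<beta>) = D (Y t \<alpha> \<beta>) (- (sin \<alpha> * cos \<beta>) *\<^sub>R Ya t \<alpha> \<beta>
        + (sin \<beta> * cos \<alpha>) *\<^sub>R Yb t \<alpha> \<beta> + sin \<alpha> *\<^sub>R (rot_gen a b ** Y t \<alpha> \<beta>))" by (rule arg_cong)
    then show ?thesis
      unfolding linear_add[OF lin] linear_cmul[OF lin]
        matrix_polys_invariant_derivative[OF D dist(1) inv]
      by (simp add: scaleR_conv_of_real)
  qed
  define \<Phi> where "\<Phi> = (\<lambda>t p. complex_of_real (sin (fst p) ^ m * sin (snd p) ^ Suc m) * H (Y t (fst p) (snd p)))"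
  define \<Phi>' where "\<Phi>' = (\<lambda>t p. complex_of_real (sin (fst p) ^ m * sin (snd p) ^ Suc m) *
      D (Y t (fst p) (snd p)) (Yt t (fst p) (snd p)))"
  define \<Phi>a where "\<Phi>a = (\<lambda>t \<alpha> \<beta>. complex_of_real (real (Suc m) * sin \<alpha> ^ m * cos \<alpha>) * H (Y t \<alpha> \<beta>)
      + complex_of_real (sin \<alpha> ^ Suc m) * D (Y t \<alpha> \<beta>) (Ya t \<alpha> \<beta>))"
  define \<Phi>b where "\<Phi>b = (\<lambda>t \<alpha> \<beta>. complex_of_real (real (Suc m) * sin \<beta> ^ m * cos \<beta>) * H (Y t \<alpha> \<beta>)
      + complex_of_real (sin \<beta> ^ Suc m) * D (Y t \<alpha> \<beta>) (Yb t \<alpha> \<beta>))"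
  have sinpow: "((\<lambda>x. complex_of_real (sin x ^ Suc m)) has_vector_derivative
      complex_of_real (real (Suc m) * sin x ^ m * cos x)) (at x)" for x
  proof (intro bounded_linear.has_vector_derivative[OF bounded_linear_of_real])
    show "((\<lambda>x. sin x ^ Suc m) has_vector_derivative real (Suc m) * sin x ^ m * cos x) (at x)"
      using DERIV_power[OF DERIV_sin, where n = "Suc m"]
      by (simp add: mult_ac flip: has_real_derivative_iff_has_vector_derivative)
  qed
  have ia: "integral {0..A} (\<lambda>\<alpha>. \<Phi>a t \<alpha> \<beta>) = 0" for t \<beta>
  proof (rule integral_deriv_zero[OF A(1)])
    show "((\<lambda>\<alpha>. complex_of_real (sin \<alpha> ^ Suc m) * H (Y t \<alpha> \<beta>)) has_vector_derivative \<Phi>a t \<alpha> \<beta>) (at \<alpha>)" for \<alpha>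
      unfolding \<Phi>a_def add.commute[of "complex_of_real (_ * _) * _"]
      by (intro has_vector_derivative_mult sinpow da)
  qed (use A in auto)
  have ib: "integral {0..pi} (\<lambda>\<beta>. \<Phi>b t \<alpha> \<beta>) = 0" for t \<alpha>
  proof (rule integral_deriv_zero)
    show "((\<lambda>\<beta>. complex_of_real (sin \<beta> ^ Suc m) * H (Y t \<alpha> \<beta>)) has_vector_derivative \<Phi>b t \<alpha> \<beta>) (at \<beta>)" for \<beta>
      unfolding \<Phi>b_def add.commute[of "complex_of_real (_ * _) * _"]
      by (intro has_vector_derivative_mult sinpow db)
  qed auto
  \<comment> \<open>The divergence form: the two terms in which the weight is differentiated cancel.\<close>
  have split: "\<Phi>' t (\<alpha>, \<beta>) = complex_of_real (sin \<alpha> ^ m * cos \<alpha>) * \<Phi>b t \<alpha> \<beta>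
      - complex_of_real (sin \<beta> ^ m * cos \<beta>) * \<Phi>a t \<alpha> \<beta>" for t \<alpha> \<beta>
  proof -
    have "\<Phi>' t (\<alpha>, \<beta>) = complex_of_real (sin \<alpha> ^ m * sin \<beta> ^ m) *
        (complex_of_real (sin \<beta>) * D (Y t \<alpha> \<beta>) (Yt t \<alpha> \<beta>))"
      by (simp add: \<Phi>'_def)
    also have "\<dots> = complex_of_real (sin \<alpha> ^ m * cos \<alpha>) * \<Phi>b t \<alpha> \<beta>
      - complex_of_real (sin \<beta> ^ m * cos \<beta>) * \<Phi>a t \<alpha> \<beta>"
      unfolding pde \<Phi>a_def \<Phi>b_def by (simp add: algebra_simps)
    finally show ?thesis .
  qed
  have cY: "continuous_on S (\<lambda>p. Y (f p) (g p) (h p))"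
    if "continuous_on S f" "continuous_on S g" "continuous_on S h"
    for S :: "'b::t2_space set" and f g h
    unfolding Y_def by (intro that continuous_intros)
  have cYt: "continuous_on S (\<lambda>p. Yt (f p) (g p) (h p))"
    if "continuous_on S f" "continuous_on S g" "continuous_on S h"
    for S :: "'b::t2_space set" and f g h
    unfolding Yt_def by (intro that continuous_intros)
  have cYa: "continuous_on S (\<lambda>p. Ya (f p) (g p) (h p))"
    if "continuous_on S f" "continuous_on S g" "continuous_on S h"
    for S :: "'b::t2_space set" and f g h
    unfolding Ya_def by (intro that continuous_intros)
  have cYb: "continuous_on S (\<lambda>p. Yb (f p) (g p) (h p))"
    if "continuous_on S f" "continuous_on S g" "continuous_on S h"
    for S :: "'b::t2_space set" and f g h
    unfolding Yb_def by (intro that continuous_intros cY)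
  note cY = cY cYt cYa cYb
  have c\<Phi>: "continuous_on S (\<Phi> t)" for S t
    unfolding \<Phi>_def by (intro cont cY)
  have c\<Phi>': "continuous_on S (\<lambda>q. \<Phi>' (fst q) (snd q))" for S
    unfolding \<Phi>'_def by (intro cont cY)
  have c\<Phi>a: "continuous_on S (\<lambda>p. complex_of_real (sin (snd p) ^ m * cos (snd p)) * \<Phi>a t (fst p) (snd p))" for S t
    unfolding \<Phi>a_def by (intro cont cY)
  have c\<Phi>b: "continuous_on S (\<lambda>p. complex_of_real (sin (fst p) ^ m * cos (fst p)) * \<Phi>b t (fst p) (snd p))" for S t
    unfolding \<Phi>b_def by (intro cont cY)
  have K_eq: "K t = integral (cbox (0, 0) (A, pi)) (\<Phi> t)" for t
  proof -
    have "integral (cbox (0, 0) (A, pi)) (\<Phi> t) = integral (cbox 0 A) (\<lambda>\<alpha>. integral (cbox 0 pi) (\<lambda>\<beta>. \<Phi> t (\<alpha>, \<beta>)))"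
      by (rule integral_prod_continuous[OF c\<Phi>])
    also have "\<dots> = K t" unfolding K_def \<Phi>_def Y_def by (simp add: mult.assoc)
    finally show ?thesis by (rule sym)
  qed
  have zero: "integral (cbox (0, 0) (A, pi)) (\<Phi>' t) = 0" for t
  proof -
    have "integral (cbox (0, 0) (A, pi)) (\<lambda>p. complex_of_real (sin (fst p) ^ m * cos (fst p)) * \<Phi>b t (fst p) (snd p)) = 0"
      unfolding integral_prod_continuous[OF c\<Phi>b] by (simp add: ib)
    moreover have "integral (cbox (0, 0) (A, pi)) (\<lambda>p. complex_of_real (sin (snd p) ^ m * cos (snd p)) * \<Phi>a t (fst p) (snd p)) = 0"
    proof -
      have "integral (cbox 0 A) (\<lambda>\<alpha>. integral (cbox 0 pi) (\<lambda>\<beta>. complex_of_real (sin \<beta> ^ m * cos \<beta>) * \<Phi>a t \<alpha> \<beta>)) =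
          integral (cbox 0 pi) (\<lambda>\<beta>. integral (cbox 0 A) (\<lambda>\<alpha>. complex_of_real (sin \<beta> ^ m * cos \<beta>) * \<Phi>a t \<alpha> \<beta>))"
        using c\<Phi>a by (intro integral_swap_continuous) (simp add: case_prod_unfold)
      also have "\<dots> = 0" by (simp add: ia)
      finally show ?thesis
        unfolding integral_prod_continuous[OF c\<Phi>a] by simp
    qed
    moreover have "\<Phi>' t = (\<lambda>p. complex_of_real (sin (fst p) ^ m * cos (fst p)) * \<Phi>b t (fst p) (snd p)
        - complex_of_real (sin (snd p) ^ m * cos (snd p)) * \<Phi>a t (fst p) (snd p))"
      using split by (auto simp: fun_eq_iff)
    ultimately show ?thesis
      by (simp only: Henstock_Kurzweil_Integration.integral_diff[OF integrable_continuous[OF c\<Phi>b] integrable_continuous[OF c\<Phi>a]] diff_self)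
  qed
  have "(K has_vector_derivative integral (cbox (0, 0) (A, pi)) (\<Phi>' t)) (at t within UNIV)" for t
    unfolding K_eq[abs_def]
  proof (rule leibniz_rule_vector_derivative)
    show "((\<lambda>t. \<Phi> t p) has_vector_derivative \<Phi>' t p) (at t within UNIV)" for t p
      unfolding \<Phi>_def \<Phi>'_def
      using bounded_linear.has_vector_derivative[OF bounded_linear_mult_right dt] by simp
    show "continuous_on (UNIV \<times> cbox (0, 0) (A, pi)) (\<lambda>(x, t). \<Phi>' x t)"
      using c\<Phi>' by (simp add: case_prod_unfold)
  qed (auto intro: integrable_continuous c\<Phi>)
  then have "(K has_derivative (\<lambda>h. 0)) (at t)" for t
    by (simp add: zero has_vector_derivative_def)
  then show ?thesis
    using has_derivative_zero_unique_connected[of UNIV K]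
    by (metis UNIV_I connected_UNIV has_derivative_at_withinI open_UNIV)
qed

section \<open>Iterated averages over Euler angles\<close>

abbreviation plane_rotation :: "(nat \<Rightarrow> 'n) \<Rightarrow> nat \<Rightarrow> real \<Rightarrow> real^'n^'n" where
  "plane_rotation e p t \<equiv> rotation (e p) (e (Suc p)) t"

definition plane_invariant :: "(nat \<Rightarrow> 'n) \<Rightarrow> nat \<Rightarrow> (real^'n^'n \<Rightarrow> complex) \<Rightarrow> bool" where
  "plane_invariant e p H \<longleftrightarrow> (\<forall>t M. H (plane_rotation e p t ** M) = H M)"

definition angle_bound :: "nat \<Rightarrow> real" where
  "angle_bound p = (if p = 1 then 2 * pi else pi)"

text \<open>
  Averages of \<open>H\<close> over left translates by rotations in the plane of the consecutive basis vectors
  \<open>e p\<close> and \<open>e (Suc p)\<close>, with the weight \<open>sin t ^ (p - 1)\<close> that spherical coordinates carry. Only in the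
  first plane does the angle run through a full circle.
\<close>

definition plane_average ::
    "(nat \<Rightarrow> 'n) \<Rightarrow> nat \<Rightarrow> (real^'n^'n \<Rightarrow> complex) \<Rightarrow> real^'n^'n \<Rightarrow> complex" where
  "plane_average e p H M = integral {0..angle_bound p}
     (\<lambda>t. complex_of_real (sin t ^ (p - 1)) * H (plane_rotation e p t ** M))"

lemma continuous_on_matrix_poly_rotation:
  assumes "F \<in> matrix_polys"
  shows "continuous_on S (\<lambda>t. complex_of_real (sin t ^ m) * F (rotation a b t ** M))"
  by (intro continuous_intros continuous_on_compose2[OF matrix_polys_continuous_on[OF assms, of UNIV]]) auto

text \<open>
  If the right factor enters \<open>F\<close> through constants \<open>b r\<close>, then so it does after averaging, since the
  average translates from the left.
\<close>

lemma plane_average_separated_at: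
  fixes F :: "real^'n^'n \<Rightarrow> complex" and R :: nat
  assumes "\<And>r. r < R \<Longrightarrow> a r \<in> matrix_polys"
    and "\<And>A. F (A ** M) = (\<Sum>r<R. a r A * (b r :: complex))"
  shows "plane_average e p F (A ** M) = (\<Sum>r<R. plane_average e p (a r) A * b r)"
proof -
  have int: "(\<lambda>t. complex_of_real (sin t ^ (p - 1)) * a r (plane_rotation e p t ** A) * b r)
      integrable_on {0..angle_bound p}" if "r < R" for r
    by (intro integrable_continuous_interval continuous_on_mult_right
        continuous_on_matrix_poly_rotation assms(1) that)
  have "plane_average e p F (A ** M) = integral {0..angle_bound p}
      (\<lambda>t. \<Sum>r<R. complex_of_real (sin t ^ (p - 1)) * a r (plane_rotation e p t ** A) * b r)"
    unfolding plane_average_def matrix_mul_assoc assms(2) by (simp add: sum_distrib_left mult.assoc)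
  also have "\<dots> = (\<Sum>r<R. integral {0..angle_bound p}
      (\<lambda>t. complex_of_real (sin t ^ (p - 1)) * a r (plane_rotation e p t ** A) * b r))"
    by (rule Henstock_Kurzweil_Integration.integral_sum) (use int in simp_all)
  also have "\<dots> = (\<Sum>r<R. plane_average e p (a r) A * b r)"
    unfolding plane_average_def by (simp only: Henstock_Kurzweil_Integration.integral_mult_left)
  finally show ?thesis .
qed

lemma plane_average_separated:
  fixes F :: "real^'n^'n \<Rightarrow> complex" and R :: nat
  assumes "\<And>r. r < R \<Longrightarrow> a r \<in> matrix_polys"
    and "\<And>A. F (A ** M) = (\<Sum>r<R. a r A * (b r :: complex))"
  shows "plane_average e p F M = (\<Sum>r<R. plane_average e p (a r) (mat 1) * b r)"
  using plane_average_separated_at[OF assms, where A = "mat 1"] by simp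

lemma plane_average_matrix_poly:
  assumes "F \<in> matrix_polys"
  shows "plane_average e p F \<in> matrix_polys"
proof -
  obtain R a b where ab: "\<And>r. r < R \<Longrightarrow> a r \<in> matrix_polys" "\<And>r. r < (R::nat) \<Longrightarrow> b r \<in> matrix_polys"
    "\<And>A B. F (A ** B) = (\<Sum>r<R. a r A * b r B)"
    by (rule matrix_polys_separate[OF assms]) (rule that)
  have "plane_average e p F = (\<lambda>M. \<Sum>r<R. plane_average e p (a r) (mat 1) * b r M)"
    by (rule ext, rule plane_average_separated[OF ab(1,3)])
  then show ?thesis
    by (simp only:) (intro matrix_polys_sum matrix_polys.mult matrix_polys.const ab(2), simp)
qed

lemma plane_invariant_average_distant:
  assumes "inj_on e {1..N}" "1 \<le> p" "p < N" "1 \<le> q" "q < N" "p + 2 \<le> q \<or> q + 2 \<le> p"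
    and "plane_invariant e p H"
  shows "plane_invariant e p (plane_average e q H)"
proof -
  have ne: "e i = e j \<longleftrightarrow> i = j" if "1 \<le> i" "i \<le> N" "1 \<le> j" "j \<le> N" for i j
    using inj_on_eq_iff[OF assms(1), of i j] that by simp
  have "plane_rotation e q s ** (plane_rotation e p t ** M) = plane_rotation e p t ** (plane_rotation e q s ** M)"
    for s t M
  proof (rule rotation_commute)
    show "{e q, e (Suc q)} \<inter> {e p, e (Suc p)} = {}"
      using assms(2-6) by (auto simp: ne)
  qed (use assms(2-6) in \<open>auto simp: ne\<close>)
  then have "H (plane_rotation e q s ** (plane_rotation e p t ** M)) =
      H (plane_rotation e p t ** (plane_rotation e q s ** M))" for s t M
    by (rule arg_cong)
  also have "\<dots> s t M = H (plane_rotation e q s ** M)" for s t M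
    using assms(7) by (simp add: plane_invariant_def)
  finally show ?thesis
    unfolding plane_invariant_def plane_average_def by (simp only:) simp
qed

lemma plane_invariant_averages_distant:
  assumes "inj_on e {1..N}" "1 \<le> p" "p < N" "\<And>q. q \<in> set qs \<Longrightarrow> 1 \<le> q \<and> q < N \<and> (p + 2 \<le> q \<or> q + 2 \<le> p)"
    and "plane_invariant e p H"
  shows "plane_invariant e p (foldr (plane_average e) qs H)"
  using assms(4)
proof (induction qs)
  case (Cons q qs)
  then show ?case
    using plane_invariant_average_distant[OF assms(1-3), of q] by simp
qed (simp add: assms(5))

lemma plane_averages_matrix_poly:
  "F \<in> matrix_polys \<Longrightarrow> foldr (plane_average e) ps F \<in> matrix_polys"
  by (induction ps) (auto intro: plane_average_matrix_poly)

text \<open>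
  In the first plane the weight is 1 and the angle runs through a period, so a translation of the
  angle changes nothing.
\<close>

lemma plane_invariant_average_first:
  assumes "e 1 \<noteq> e 2" "H \<in> matrix_polys"
  shows "plane_invariant e 1 (plane_average e 1 H)"
  unfolding plane_invariant_def
proof (intro allI)
  fix t M
  define h where "h = (\<lambda>s. H (rotation (e 1) (e 2) s ** M))"
  have ch: "continuous_on S h" for S
    unfolding h_def using continuous_on_matrix_poly_rotation[OF assms(2), of S 0] by simp
  have per: "h (s + 2 * pi) = h s" for s by (simp add: h_def)
  have cmb: "integral {u..v} h + integral {v..w} h = integral {u..w} h" if "u \<le> v" "v \<le> w" for u v w
    by (rule Henstock_Kurzweil_Integration.integral_combine[OF that integrable_continuous_interval[OF ch]])
  obtain c where c: "0 \<le> c" "c < 2 * pi" "cos t = cos c" "sin t = sin c"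
    by (rule sincos_total_2pi[of "cos t" "sin t"]) auto
  have "integral {0..2 * pi} (\<lambda>s. h (c + s)) = integral {c..2 * pi + c} h"
    using integral_shift_Icc_real[of 0 "2 * pi" h c] by (simp add: o_def)
  also have "\<dots> = integral {c..2 * pi} h + integral {2 * pi..2 * pi + c} h"
    using c by (intro cmb[symmetric]) auto
  also have "integral {2 * pi..2 * pi + c} h = integral {0..c} h"
    using integral_shift_Icc_real[of 0 c h "2 * pi"] by (simp add: o_def per add.commute)
  also have "integral {c..2 * pi} h + integral {0..c} h = integral {0..2 * pi} h"
    using cmb[of 0 c "2 * pi"] c by (simp add: add.commute)
  finally have "integral {0..2 * pi} (\<lambda>s. h (c + s)) = integral {0..2 * pi} h" .
  then show "plane_average e 1 H (plane_rotation e 1 t ** M) = plane_average e 1 H M"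
    using assms(1)
    by (simp add: plane_average_def angle_bound_def c(3,4) rotation_add h_def add.commute flip: numeral_2_eq_2)
qed

lemma plane_invariant_average_step:
  assumes "inj_on e {1..N}" "2 \<le> p" "p < N" "H \<in> matrix_polys" "plane_invariant e (p - 1) H"
  shows "plane_invariant e p (plane_average e (p - 1) (plane_average e p H))"
proof -
  obtain m where m: "p = m + 2" using assms(2) by (metis add.commute le_Suc_ex)
  have ne: "e i = e j \<longleftrightarrow> i = j" if "1 \<le> i" "i \<le> N" "1 \<le> j" "j \<le> N" for i j
    using inj_on_eq_iff[OF assms(1), of i j] that by simp
  have d: "e (m + 1) \<noteq> e (m + 2)" "e (m + 2) \<noteq> e (m + 3)" "e (m + 1) \<noteq> e (m + 3)"
    using assms(3) m by (auto simp: ne)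
  have inv: "H (rotation (e (m + 1)) (e (m + 2)) t ** M) = H M" for t M
    using assms(5) by (simp add: plane_invariant_def m)
  have "0 \<le> angle_bound (m + 1)" "sin (angle_bound (m + 1)) = 0"
    by (auto simp: angle_bound_def)
  note K = two_angle_average_invariant[OF assms(4) d inv this, of m]
  have e: "plane_average e (p - 1) (plane_average e p H) (plane_rotation e p t ** M) =
      integral {0..angle_bound (m + 1)} (\<lambda>\<alpha>. complex_of_real (sin \<alpha> ^ m) * integral {0..pi} (\<lambda>\<beta>.
        complex_of_real (sin \<beta> ^ Suc m) * H (rotation (e (m + 2)) (e (m + 3)) \<beta> **
          (rotation (e (m + 1)) (e (m + 2)) \<alpha> ** (rotation (e (m + 2)) (e (m + 3)) t ** M)))))" for t M
  proof -
    have "p - 1 = m + 1" "Suc (m + 1) = m + 2" "Suc (m + 2) = m + 3" "m + 2 - 1 = Suc m" "m + 1 - 1 = m"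
      "angle_bound (m + 2) = pi"
      by (auto simp: m angle_bound_def)
    then show ?thesis unfolding plane_average_def m by (simp only:)
  qed
  show ?thesis
    unfolding plane_invariant_def
  proof (intro allI)
    fix t M
    let ?A = "plane_average e (p - 1) (plane_average e p H)"
    have "?A (plane_rotation e p t ** M) = ?A (plane_rotation e p 0 ** M)"
      unfolding e by (rule K)
    also have "plane_rotation e p 0 ** M = M"
      by (rule rotation_0) (use assms(2,3) ne in simp)
    finally show "?A (plane_rotation e p t ** M) = ?A M" .
  qed
qed

text \<open>
  Rotations in the plane \<open>p\<close> commute with the averages over all planes except \<open>p - 1\<close>, \<open>p\<close> and
  \<open>p + 1\<close>. The average over \<open>p + 1\<close> stands inside those over \<open>p - 1\<close> and \<open>p\<close>, and it keeps the invariance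
  under \<open>p - 1\<close>, which is what the two-angle lemma needs. So one block of averages extends the
  invariance by one more plane.
\<close>

lemma block_average_invariant:
  assumes inj: "inj_on e {1..N}" and n: "n \<le> N" and p: "1 \<le> p" "p < n" and H: "H \<in> matrix_polys"
    and inv: "\<And>q. 1 \<le> q \<Longrightarrow> Suc q < n \<Longrightarrow> plane_invariant e q H"
  shows "plane_invariant e p (foldr (plane_average e) [1..<n] H)"
proof (cases "p = 1")
  case True
  have "[1..<n] = 1 # [Suc 1..<n]" using p by (intro upt_conv_Cons) simp
  moreover have "e 1 \<noteq> e 2"
    using inj n p by (auto dest: inj_onD)
  ultimately show ?thesis
    using True plane_invariant_average_first[of e] plane_averages_matrix_poly[OF H] by simp
next
  case False
  define G where "G = foldr (plane_average e) [Suc p..<n] H"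
  have G: "G \<in> matrix_polys" unfolding G_def by (rule plane_averages_matrix_poly[OF H])
  have "[1..<n] = [1..<p - 1] @ (p - 1) # p # [Suc p..<n]"
  proof -
    have "[1..<n] = [1..<p - 1] @ [p - 1..<n]" using upt_add_eq_append[of 1 "p - 1" "n - (p - 1)"] p False by simp
    also have "[p - 1..<n] = (p - 1) # [p..<n]" using p False by (subst upt_conv_Cons) auto
    also have "[p..<n] = p # [Suc p..<n]" using p by (subst upt_conv_Cons) auto
    finally show ?thesis .
  qed
  then have "foldr (plane_average e) [1..<n] H =
      foldr (plane_average e) [1..<p - 1] (plane_average e (p - 1) (plane_average e p G))"
    by (simp add: G_def)
  moreover have "plane_invariant e (p - 1) G"
    unfolding G_def
    by (rule plane_invariant_averages_distant[OF inj]) (use p n False inv in auto)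
  then have "plane_invariant e p (plane_average e (p - 1) (plane_average e p G))"
    using p n False G by (intro plane_invariant_average_step[OF inj]) auto
  then have "plane_invariant e p
      (foldr (plane_average e) [1..<p - 1] (plane_average e (p - 1) (plane_average e p G)))"
    by (rule plane_invariant_averages_distant[OF inj, rotated 3]) (use p n in auto)
  ultimately show ?thesis by simp
qed

text \<open>
  The planes of the generalised Euler angles: one block for each of the spheres
  \<open>S\<^sup>n\<^sup>-\<^sup>1 = SO(n) / SO(n - 1)\<close>, the largest block first.
\<close>

primrec euler_planes :: "nat \<Rightarrow> nat list" where
  "euler_planes 0 = []"
| "euler_planes (Suc n) = [1..<Suc n] @ euler_planes n"

lemma euler_average_invariant:
  assumes "inj_on e {1..N}" "n \<le> N" "F \<in> matrix_polys" "1 \<le> p" "p < n"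
  shows "plane_invariant e p (foldr (plane_average e) (euler_planes n) F)"
  using assms(2,4,5)
proof (induction n arbitrary: p)
  case (Suc n)
  have "plane_invariant e p (foldr (plane_average e) [1..<Suc n] (foldr (plane_average e) (euler_planes n) F))"
    by (rule block_average_invariant[OF assms(1)])
      (use Suc in \<open>auto intro: plane_averages_matrix_poly assms(3)\<close>)
  then show ?case by simp
qed simp


section \<open>Generation of the rotation group by plane rotations\<close>

text \<open>
  The determinant is 1, and not \<open>-1\<close>, because the rotation is the square of the rotation by half the
  angle.
\<close>

lemma rotation_in_SO:
  fixes a b :: "'n::finite"
  assumes "a \<noteq> b"
  shows "rotation a b t \<in> SO"
proof -
  have tr: "transpose (rotation a b t) = rotation a b (- t)" for t
    using assms by (auto simp: vec_eq_iff transpose_def givens_def)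
  have orth: "orthogonal_matrix (rotation a b t)" for t
    unfolding orthogonal_matrix tr
    using rotation_add[OF assms, of "- t" t "mat 1"]
      rotation_0[OF assms, of "mat 1"]
    by simp
  have "rotation a b t = rotation a b (t / 2) ** rotation a b (t / 2)"
    using rotation_add[OF assms, of "t / 2" "t / 2" "mat 1"] by simp
  then have "det (rotation a b t) = det (rotation a b (t / 2)) * det (rotation a b (t / 2))"
    by (metis det_mul)
  also have "\<dots> = 1"
    using det_orthogonal_matrix[OF orth, of "t / 2"] by auto
  finally show ?thesis using orth by (simp add: SO_def rotation_matrix_def)
qed

lemma SO_mult: "A \<in> SO \<Longrightarrow> B \<in> SO \<Longrightarrow> A ** B \<in> SO"
  by (auto simp: SO_def rotation_matrix_def det_mul orthogonal_matrix_mul)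

lemma SO_transpose: "A \<in> SO \<Longrightarrow> transpose A \<in> SO"
  by (auto simp: SO_def rotation_matrix_def det_transpose)

lemma SO_inverse:
  assumes "A \<in> SO"
  shows "transpose A ** A = mat 1" "A ** transpose A = mat 1"
  using assms by (auto simp: SO_def rotation_matrix_def orthogonal_matrix_def)

lemma SO_rows:
  fixes A :: "real^'n^'n"
  assumes "A \<in> SO"
  shows "(\<Sum>k\<in>UNIV. A $ i $ k * A $ j $ k) = (if i = j then 1 else 0)"
proof -
  have "(A ** transpose A) $ i $ j = (mat 1 :: real^'n^'n) $ i $ j"
    by (simp add: SO_inverse[OF assms])
  then show ?thesis by (simp add: matrix_matrix_mult_def transpose_def Finite_Cartesian_Product.mat_def)
qed

lemma SO_columns:
  fixes A :: "real^'n^'n"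
  assumes "A \<in> SO"
  shows "(\<Sum>k\<in>UNIV. A $ k $ i * A $ k $ j) = (if i = j then 1 else 0)"
  using SO_rows[OF SO_transpose[OF assms], of i j] by (simp add: transpose_def)

text \<open>
  Givens elimination: rotations in the planes \<open>1, \<dots>, j - 1\<close> push the first entries of the column \<open>c\<close>
  into the row \<open>j\<close>, one after the other, where they leave a nonnegative entry. A function that is
  invariant under these rotations does not notice.
\<close>

lemma givens_clear_column:
  fixes g :: "real^'n^'n"
  assumes inj: "inj_on e {1..N}" and H: "\<And>p. 1 \<le> p \<Longrightarrow> p < N \<Longrightarrow> plane_invariant e p H"
    and g: "g \<in> SO" and j: "1 \<le> j" "j \<le> n" "n \<le> N"
  shows "\<exists>g' \<in> SO. H g' = H g \<and> (\<forall>i\<in>{n<..N}. g' $ e i = g $ e i) \<and>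
    (\<forall>i\<in>{1..<j}. g' $ e i $ c = 0) \<and> (2 \<le> j \<longrightarrow> 0 \<le> g' $ e j $ c)"
  using j(1,2)
proof (induction j rule: nat_induct_at_least)
  case base
  show ?case using g by (intro bexI[of _ g]) auto
next
  case (Suc j)
  then obtain g' where g': "g' \<in> SO" "H g' = H g" "\<forall>i\<in>{n<..N}. g' $ e i = g $ e i"
    "\<forall>i\<in>{1..<j}. g' $ e i $ c = 0" by auto
  have ne: "e i = e k \<longleftrightarrow> i = k" if "1 \<le> i" "i \<le> N" "1 \<le> k" "k \<le> N" for i k
    using inj_on_eq_iff[OF inj, of i k] that by simp
  define x where "x = g' $ e j $ c"
  define y where "y = g' $ e (Suc j) $ c"
  obtain t where t: "cos t * x - sin t * y = 0" "0 \<le> sin t * x + cos t * y"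
  proof (cases "x = 0 \<and> y = 0")
    case True
    then show thesis by (intro that[of 0]) auto
  next
    case False
    define r where "r = sqrt (x\<^sup>2 + y\<^sup>2)"
    have "0 < x\<^sup>2 + y\<^sup>2" using False by (simp add: sum_power2_gt_zero_iff)
    then have r: "r > 0" "r\<^sup>2 = x\<^sup>2 + y\<^sup>2" by (auto simp: r_def)
    \<comment> \<open>The angle that turns the pair of entries \<open>(x, y)\<close> into \<open>(0, r)\<close>.\<close>
    have "(y / r)\<^sup>2 + (x / r)\<^sup>2 = 1"
    proof -
      have "(y / r)\<^sup>2 + (x / r)\<^sup>2 = (x\<^sup>2 + y\<^sup>2) / r\<^sup>2"
        by (simp add: power_divide add_divide_distrib)
      also have "\<dots> = 1" unfolding r(2)[symmetric] using r(1) by simp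
      finally show ?thesis .
    qed
    then obtain t where "y / r = cos t" "x / r = sin t" by (rule sincos_total_2pi)
    then have ct: "cos t = y / r" "sin t = x / r" by simp_all
    show thesis
    proof (rule that[of t])
      have "sin t * x + cos t * y = r"
        using r unfolding ct by (simp add: field_simps power2_eq_square)
      then show "0 \<le> sin t * x + cos t * y" using r by simp
    qed (simp add: ct)
  qed
  have d: "e j \<noteq> e (Suc j)" using ne[of j "Suc j"] Suc j by auto
  define h where "h = plane_rotation e j t ** g'"
  have row: "h $ i = (if i = e j then cos t *\<^sub>R g' $ e j - sin t *\<^sub>R g' $ e (Suc j)
     else if i = e (Suc j) then sin t *\<^sub>R g' $ e j + cos t *\<^sub>R g' $ e (Suc j) else g' $ i)" for i
    unfolding h_def by (rule givens_mult_row[OF d])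
  show ?case
  proof (intro bexI[of _ h] conjI ballI impI)
    show "h \<in> SO" unfolding h_def by (intro SO_mult rotation_in_SO d g')
    show "H h = H g"
      using H[of j] Suc j g'(2) by (simp add: h_def plane_invariant_def)
    show "h $ e i = g $ e i" if "i \<in> {n<..N}" for i
      using that Suc j g'(3) by (simp add: row ne)
    show "h $ e i $ c = 0" if "i \<in> {1..<Suc j}" for i
      using that Suc j g'(4) t(1) by (cases "i = j") (auto simp: row ne x_def y_def)
    show "0 \<le> h $ e (Suc j) $ c"
      using d t(2) by (simp add: row x_def y_def)
  qed
qed

text \<open>
  Rotations in adjacent planes generate the group: elimination makes the last column, hence also the
  last row, that of the identity, and then continues in the smaller group. In the end a single
  diagonal entry is left, which is 1 by the determinant.
\<close>

lemma plane_invariant_constant_on_SO: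
  fixes e :: "nat \<Rightarrow> 'n::finite" and H :: "real^'n^'n \<Rightarrow> complex"
  assumes bij: "bij_betw e {1..N} UNIV" and N: "1 \<le> N"
    and H: "\<And>p. 1 \<le> p \<Longrightarrow> p < N \<Longrightarrow> plane_invariant e p H"
    and g: "g \<in> SO"
  shows "H g = H (mat 1)"
proof -
  have inj: "inj_on e {1..N}" using bij by (simp add: bij_betw_def)
  have ne: "e i = e k \<longleftrightarrow> i = k" if "1 \<le> i" "i \<le> N" "1 \<le> k" "k \<le> N" for i k
    using inj_on_eq_iff[OF inj, of i k] that by simp
  have surj: "\<exists>k\<in>{1..N}. i = e k" for i
    using bij by (metis UNIV_I bij_betw_def image_iff)
  have "\<forall>g\<in>SO. (\<forall>i\<in>{n<..N}. g $ e i = axis (e i) 1) \<longrightarrow> H g = H (mat 1)"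
    if "1 \<le> n" "n \<le> N" for n
    using that
  proof (induction n rule: nat_induct_at_least)
    case base
    show ?case
    proof (intro ballI impI)
      fix g :: "real^'n^'n"
      assume g: "g \<in> SO" and rows: "\<forall>i\<in>{1<..N}. g $ e i = axis (e i) 1"
      have r: "g $ i = axis i 1" if "i \<noteq> e 1" for i
      proof -
        obtain k where "k \<in> {1..N}" "i = e k" using surj by blast
        then show ?thesis using rows that by (cases "k = 1") auto
      qed
      have off: "g $ e 1 $ i = 0" if "i \<noteq> e 1" for i
        using SO_rows[OF g, of "e 1" i] that r[OF that]
        by (simp add: axis_def if_distrib[of "\<lambda>x. _ * x"] cong: if_cong)
      have "det g = prod (\<lambda>i. g $ i $ i) UNIV"
      proof (rule det_diagonal)
        fix i j :: 'n assume "i \<noteq> j"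
        then show "g $ i $ j = 0" using off r by (cases "i = e 1") (auto simp: axis_def)
      qed
      also have "\<dots> = g $ e 1 $ e 1 * prod (\<lambda>i. g $ i $ i) (UNIV - {e 1})"
        by (rule prod.remove) auto
      also have "prod (\<lambda>i. g $ i $ i) (UNIV - {e 1}) = 1"
        using r by (intro prod.neutral) (auto simp: axis_def)
      finally have "g $ e 1 $ e 1 = 1"
        using g by (simp add: SO_def rotation_matrix_def)
      then have "g $ i $ j = (mat 1 :: real^'n^'n) $ i $ j" for i j
        using off r by (cases "i = e 1") (auto simp: axis_def Finite_Cartesian_Product.mat_def)
      then have "g = mat 1"
        by (simp add: vec_eq_iff)
      then show "H g = H (mat 1)" by simp
    qed
  next
    case (Suc n)
    show ?case
    proof (intro ballI impI)
      fix g :: "real^'n^'n"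
      assume g: "g \<in> SO" and rows: "\<forall>i\<in>{Suc n<..N}. g $ e i = axis (e i) 1"
      let ?c = "e (Suc n)"
      have "\<exists>g'\<in>SO. H g' = H g \<and> (\<forall>i\<in>{Suc n<..N}. g' $ e i = g $ e i) \<and>
          (\<forall>i\<in>{1..<Suc n}. g' $ e i $ ?c = 0) \<and> (2 \<le> Suc n \<longrightarrow> 0 \<le> g' $ ?c $ ?c)"
        by (rule givens_clear_column[OF inj H g]) (use Suc in auto)
      then obtain g' where g': "g' \<in> SO" "H g' = H g" "\<And>i. i \<in> {Suc n<..N} \<Longrightarrow> g' $ e i = axis (e i) 1"
        "\<And>i. i \<in> {1..<Suc n} \<Longrightarrow> g' $ e i $ ?c = 0" "0 \<le> g' $ ?c $ ?c"
        using Suc rows by auto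
      have off: "g' $ i $ ?c = 0" if "i \<noteq> ?c" for i
      proof -
        obtain k where k: "k \<in> {1..N}" "i = e k" using surj by blast
        then have "k \<noteq> Suc n" using that by auto
        then show ?thesis using k g'(3)[of k] g'(4)[of k] that
          by (cases "k < Suc n") (auto simp: axis_def)
      qed
      have "(\<Sum>k\<in>UNIV. g' $ k $ ?c * g' $ k $ ?c) = g' $ ?c $ ?c * g' $ ?c $ ?c"
        using off by (subst sum.remove[of _ ?c]) auto
      then have "(g' $ ?c $ ?c)\<^sup>2 = 1"
        using SO_columns[OF g'(1), of ?c ?c] by (simp add: power2_eq_square)
      then have one: "g' $ ?c $ ?c = 1"
        using g'(5) by (simp add: power2_eq_1_iff)
      have "(\<Sum>k\<in>UNIV. g' $ ?c $ k * g' $ ?c $ k) = g' $ ?c $ ?c * g' $ ?c $ ?c + (\<Sum>k\<in>UNIV - {?c}. g' $ ?c $ k * g' $ ?c $ k)"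
        by (rule sum.remove) auto
      then have "(\<Sum>k\<in>UNIV - {?c}. g' $ ?c $ k * g' $ ?c $ k) = 0"
        using SO_rows[OF g'(1), of ?c ?c] one by simp
      then have "g' $ ?c $ k = 0" if "k \<noteq> ?c" for k
        using that by (subst (asm) sum_nonneg_eq_0_iff) auto
      then have "g' $ ?c = axis ?c 1"
        using one by (simp add: vec_eq_iff axis_def)
      then have "g' $ e i = axis (e i) 1" if "i \<in> {n<..N}" for i
        using g'(3)[of i] that by (cases "i = Suc n") auto
      then show "H g = H (mat 1)"
        using Suc g' by auto
    qed
  qed
  from this[of N] show ?thesis using g N by auto
qed

section \<open>Haar measure as an average over Euler angles\<close>

lemma compact_SO: "compact (SO :: (real^'n^'n) set)"
proof -
  have "closed (SO :: (real^'n^'n) set)"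
  proof -
    have eq: "SO = {A :: real^'n^'n. transpose A ** A = mat 1} \<inter> {A. det A = 1}"
      by (auto simp: SO_def rotation_matrix_def orthogonal_matrix)
    moreover
    have "continuous_on UNIV (\<lambda>A :: real^'n^'n. transpose A ** A)"
      unfolding transpose_def by (intro continuous_intros continuous_on_vec_lambda)
    moreover have "continuous_on UNIV (\<lambda>A :: real^'n^'n. det A)"
      unfolding Determinants.det_def by (intro continuous_intros)
    ultimately show ?thesis
      by (subst eq) (intro closed_Int closed_Collect_eq continuous_on_const)
  qed
  moreover have "bounded (SO :: (real^'n^'n) set)"
  proof (rule boundedI)
    fix A :: "real^'n^'n" assume A: "A \<in> SO"
    have row: "norm (A $ i) = 1" for i
      using SO_rows[OF A, of i i] by (simp add: norm_eq_sqrt_inner inner_vec_def)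
    have "norm A \<le> (\<Sum>i\<in>UNIV. norm (A $ i))"
      unfolding norm_vec_def by (rule L2_set_le_sum) simp
    then show "norm A \<le> real CARD('n)" by (simp add: row)
  qed
  ultimately show ?thesis by (simp add: compact_eq_bounded_closed)
qed

lemma haar_space: "haar_measure_on G \<mu> \<Longrightarrow> space \<mu> = G"
  unfolding haar_measure_on_def
  by (metis sets_eq_imp_space_eq space_borel space_restrict_space2 space_restrict_space Int_UNIV_right)

lemma haar_finite_measure:
  assumes "haar_measure_on G \<mu>"
  shows "finite_measure \<mu>"
  using assms haar_space[OF assms] by (intro finite_measureI) (simp add: haar_measure_on_def)

lemma haar_integrable:
  fixes F :: "real^'n^'n \<Rightarrow> complex"
  assumes \<mu>: "haar_measure_on SO \<mu>" and F: "continuous_on SO F"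
  shows "integrable \<mu> F"
proof -
  interpret finite_measure \<mu> by (rule haar_finite_measure[OF \<mu>])
  have "F \<in> borel_measurable (restrict_space borel SO)"
    by (rule borel_measurable_continuous_on_restrict[OF F])
  then have meas: "F \<in> borel_measurable \<mu>"
    using \<mu> by (subst measurable_cong_sets[of _ "restrict_space borel SO" _ borel]) (auto simp: haar_measure_on_def)
  have "bounded (F ` SO)"
    by (intro compact_imp_bounded compact_continuous_image F compact_SO)
  then obtain B where "\<And>x. x \<in> SO \<Longrightarrow> norm (F x) \<le> B"
    by (auto simp: bounded_iff)
  then show ?thesis
    using meas haar_space[OF \<mu>] by (intro integrable_const_bound[of F B]) auto
qed

lemma haar_invariant:
  fixes F :: "real^'n^'n \<Rightarrow> complex"
  assumes \<mu>: "haar_measure_on SO \<mu>" and F: "continuous_on SO F" and A: "A \<in> SO"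
  shows "(LINT g|\<mu>. F (A ** g)) = (LINT g|\<mu>. F g)"
proof -
  have sets: "sets \<mu> = sets (restrict_space borel SO)" and inv: "distr \<mu> \<mu> (\<lambda>x. A ** x) = \<mu>"
    using \<mu> A by (auto simp: haar_measure_on_def)
  have "continuous_on SO (\<lambda>g. A ** g)" by (intro continuous_intros)
  then have "(\<lambda>g. A ** g) \<in> measurable (restrict_space borel SO) (restrict_space borel SO)"
    by (intro measurable_restrict_space2 borel_measurable_continuous_on_restrict)
      (auto simp: space_restrict_space intro: SO_mult A)
  then have m: "(\<lambda>g. A ** g) \<in> measurable \<mu> \<mu>"
    by (simp add: measurable_cong_sets[OF sets sets])
  have "integrable \<mu> F" by (rule haar_integrable[OF \<mu> F])
  then have "(LINT g|distr \<mu> \<mu> (\<lambda>x. A ** x). F g) = (LINT g|\<mu>. F (A ** g))"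
    by (intro integral_distr[OF m]) auto
  then show ?thesis by (simp add: inv)
qed

definition plane_mass :: "nat \<Rightarrow> complex" where
  "plane_mass p = integral {0..angle_bound p} (\<lambda>t. complex_of_real (sin t ^ (p - 1)))"

lemma plane_mass_nonzero:
  assumes "1 \<le> p"
  shows "plane_mass p \<noteq> 0"
proof (cases "p = 1")
  case True
  then show ?thesis by (simp add: plane_mass_def angle_bound_def)
next
  case False
  have cont: "continuous_on {0..pi} (\<lambda>t. sin t ^ (p - 1))" by (intro continuous_intros)
  have "integral {0..pi} (\<lambda>t. sin t ^ (p - 1)) \<noteq> 0"
  proof
    assume "integral {0..pi} (\<lambda>t. sin t ^ (p - 1)) = 0"
    then have "\<forall>t\<in>{0..pi}. sin t ^ (p - 1) = 0"
      by (subst (asm) integral_eq_0_iff[OF cont]) (auto simp: sin_ge_zero)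
    then have "sin (pi / 2) ^ (p - 1) = 0" by (rule bspec) auto
    then show False by simp
  qed
  moreover have "plane_mass p = complex_of_real (integral {0..pi} (\<lambda>t. sin t ^ (p - 1)))"
    unfolding plane_mass_def using False integrable_continuous_interval[OF cont]
    using integral_linear[OF integrable_continuous_interval[OF cont] bounded_linear_of_real]
    by (simp add: angle_bound_def o_def)
  ultimately show ?thesis by simp
qed

text \<open>
  The Haar integral of a translate does not depend on the translation, so averaging over
  rotations only multiplies it by the total weight.
\<close>

lemma haar_plane_average:
  fixes F :: "real^'n^'n \<Rightarrow> complex"
  assumes \<mu>: "haar_measure_on SO \<mu>" and F: "F \<in> matrix_polys" and ne: "e p \<noteq> e (Suc p)"
  shows "(LINT g|\<mu>. plane_average e p F g) = plane_mass p * (LINT g|\<mu>. F g)"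
proof -
  obtain R a b where ab: "\<And>r. r < R \<Longrightarrow> a r \<in> matrix_polys" "\<And>r. r < (R::nat) \<Longrightarrow> b r \<in> matrix_polys"
    "\<And>A B. F (A ** B) = (\<Sum>r<R. a r A * b r B)"
    by (rule matrix_polys_separate[OF F]) (rule that)
  define \<beta> where "\<beta> r = (LINT g|\<mu>. b r g)" for r
  define G where "G A = (\<Sum>r<R. a r A * \<beta> r)" for A
  have ib: "integrable \<mu> (b r)" if "r < R" for r
    by (intro haar_integrable \<mu> matrix_polys_continuous_on ab(2) that)
  have lin: "(LINT g|\<mu>. (\<Sum>r<R. c r * b r g)) = (\<Sum>r<R. c r * \<beta> r)" for c
    unfolding \<beta>_def using ib by (subst Bochner_Integration.integral_sum) auto
  have G: "G A = (LINT g|\<mu>. F g)" if "A \<in> SO" for A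
    using haar_invariant[OF \<mu> matrix_polys_continuous_on[OF F] that]
    unfolding G_def ab(3) lin .
  have "(LINT g|\<mu>. plane_average e p F g) = (\<Sum>r<R. plane_average e p (a r) (mat 1) * \<beta> r)"
    by (subst lin[symmetric], rule Bochner_Integration.integral_cong)
      (simp_all add: plane_average_separated[OF ab(1,3)])
  also have "\<dots> = plane_average e p G (mat 1)"
    by (rule plane_average_separated[OF ab(1), symmetric]) (simp_all add: G_def)
  also have "\<dots> = plane_mass p * (LINT g|\<mu>. F g)"
    using G[OF rotation_in_SO[OF ne]] by (simp add: plane_average_def plane_mass_def)
  finally show ?thesis .
qed

lemma haar_plane_averages:
  fixes F :: "real^'n^'n \<Rightarrow> complex"
  assumes \<mu>: "haar_measure_on SO \<mu>" and F: "F \<in> matrix_polys"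
    and ne: "\<And>p. p \<in> set ps \<Longrightarrow> e p \<noteq> e (Suc p)"
  shows "(LINT g|\<mu>. foldr (plane_average e) ps F g) = (\<Prod>p\<leftarrow>ps. plane_mass p) * (LINT g|\<mu>. F g)"
  using ne
  by (induction ps) (simp_all add: haar_plane_average[OF \<mu> plane_averages_matrix_poly[OF F]])

lemma euler_planes_bounds: "p \<in> set (euler_planes n) \<Longrightarrow> 1 \<le> p \<and> p < n"
  by (induction n) auto

text \<open>
  The iterated average is invariant under all adjacent rotations, hence constant on the group, and so
  equal to its own Haar integral. The left invariance of \<open>\<mu>\<close> evaluates this integral.
\<close>

theorem euler_average_eq_haar:
  fixes e :: "nat \<Rightarrow> 'n::finite" and F :: "real^'n^'n \<Rightarrow> complex"
  assumes bij: "bij_betw e {1..N} UNIV" and N: "1 \<le> N"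
    and \<mu>: "haar_measure_on SO \<mu>" and F: "F \<in> matrix_polys"
  shows "foldr (plane_average e) (euler_planes N) F (mat 1) =
    (\<Prod>p\<leftarrow>euler_planes N. plane_mass p) * (LINT g|\<mu>. F g)"
proof -
  have inj: "inj_on e {1..N}" using bij by (simp add: bij_betw_def)
  let ?T = "foldr (plane_average e) (euler_planes N) F"
  have const: "?T g = ?T (mat 1)" if "g \<in> SO" for g
    using plane_invariant_constant_on_SO[OF bij N euler_average_invariant[OF inj order_refl F] that] .
  have "(LINT g|\<mu>. ?T g) = (LINT g|\<mu>. ?T (mat 1))"
    by (rule Bochner_Integration.integral_cong) (auto simp: haar_space[OF \<mu>] const)
  also have "\<dots> = ?T (mat 1)"
    using \<mu> haar_space[OF \<mu>] by (simp add: haar_measure_on_def measure_def)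
  finally have "?T (mat 1) = (LINT g|\<mu>. ?T g)" by simp
  also have "\<dots> = (\<Prod>p\<leftarrow>euler_planes N. plane_mass p) * (LINT g|\<mu>. F g)"
  proof (rule haar_plane_averages[OF \<mu> F])
    fix p assume "p \<in> set (euler_planes N)"
    then show "e p \<noteq> e (Suc p)"
      using inj_on_eq_iff[OF inj, of p "Suc p"] euler_planes_bounds[of p N] by auto
  qed
  finally show ?thesis .
qed

lemma euler_mass_nonzero: "(\<Prod>p\<leftarrow>euler_planes n. plane_mass p) \<noteq> 0"
  using plane_mass_nonzero euler_planes_bounds by (auto simp: prod_list_zero_iff)

section \<open>Functions of finite type are polynomials\<close>

text \<open>
  A vector in the kernel contradicts the hypothesis at an entry of largest modulus.
\<close>

lemma near_identity_left_inverse: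
  fixes A :: "complex mat"
  assumes A: "A \<in> carrier_mat d d"
    and near: "\<And>i. i < d \<Longrightarrow> (\<Sum>j<d. cmod (A $$ (i, j) - (if i = j then 1 else 0))) < 1"
  obtains B where "B \<in> carrier_mat d d" "B * A = 1\<^sub>m d"
proof -
  have "Determinant.det A \<noteq> 0"
  proof
    assume "Determinant.det A = 0"
    then obtain v where v: "v \<in> carrier_vec d" "v \<noteq> 0\<^sub>v d" "A *\<^sub>v v = 0\<^sub>v d"
      using det_0_iff_vec_prod_zero[OF A] by auto
    then obtain i0 where i0: "i0 < d" "vec_index v i0 \<noteq> 0"
      by (metis carrier_vecD eq_vecI index_zero_vec)
    let ?S = "(\<lambda>i. cmod (vec_index v i)) ` {..<d}"
    have "Max ?S \<in> ?S" using i0 by (intro Max_in) auto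
    then obtain i where i: "i < d" "Max ?S = cmod (vec_index v i)" by auto
    have imax: "cmod (vec_index v j) \<le> cmod (vec_index v i)" if "j < d" for j
      unfolding i(2)[symmetric] using that by (intro Max_ge) auto
    have pos: "cmod (vec_index v i) > 0" using imax[OF i0(1)] i0(2) by auto
    have "0 = (\<Sum>j<d. A $$ (i, j) * vec_index v j)"
    proof -
      have "0 = vec_index (A *\<^sub>v v) i" using v(3) i by simp
      also have "\<dots> = (\<Sum>j<d. A $$ (i, j) * vec_index v j)"
        using A v(1) i by (simp add: scalar_prod_def atLeast0LessThan)
      finally show ?thesis .
    qed
    also have "\<dots> = (\<Sum>j<d. (A $$ (i, j) - (if i = j then 1 else 0)) * vec_index v j) + vec_index v i"
      using i by (simp add: left_diff_distrib sum_subtractf if_distrib[of "\<lambda>x. x * _"] cong: if_cong)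
    finally have "vec_index v i = - (\<Sum>j<d. (A $$ (i, j) - (if i = j then 1 else 0)) * vec_index v j)"
      by (simp add: eq_neg_iff_add_eq_0 add.commute)
    then have "cmod (vec_index v i) = cmod (\<Sum>j<d. (A $$ (i, j) - (if i = j then 1 else 0)) * vec_index v j)"
      by (simp only: norm_minus_cancel)
    also have "\<dots> \<le> (\<Sum>j<d. cmod ((A $$ (i, j) - (if i = j then 1 else 0)) * vec_index v j))"
      by (rule norm_sum)
    also have "\<dots> \<le> (\<Sum>j<d. cmod (A $$ (i, j) - (if i = j then 1 else 0)) * cmod (vec_index v i))"
      by (intro sum_mono) (auto simp: norm_mult intro!: mult_left_mono imax)
    also have "\<dots> = (\<Sum>j<d. cmod (A $$ (i, j) - (if i = j then 1 else 0))) * cmod (vec_index v i)"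
      by (simp add: sum_distrib_right)
    also have "\<dots> < 1 * cmod (vec_index v i)"
      using near[OF i(1)] pos by (intro mult_strict_right_mono)
    finally show False by simp
  qed
  then have "A \<in> Units (ring_mat TYPE(complex) d ())"
    by (rule det_non_zero_imp_unit[OF A])
  then show thesis
    using that by (auto simp: Units_def ring_mat_def)
qed

lemma haar_integral_norm_bound:
  fixes F :: "real^'n^'n \<Rightarrow> complex"
  assumes \<mu>: "haar_measure_on SO \<mu>" and F: "continuous_on SO F" and B: "\<And>g. g \<in> SO \<Longrightarrow> cmod (F g) \<le> B"
  shows "cmod (LINT g|\<mu>. F g) \<le> B"
proof -
  interpret finite_measure \<mu> by (rule haar_finite_measure[OF \<mu>])
  have "cmod (LINT g|\<mu>. F g) \<le> (LINT g|\<mu>. cmod (F g))" by (rule integral_norm_bound)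
  also have "\<dots> \<le> (LINT g|\<mu>. B)"
    using haar_integrable[OF \<mu> F] haar_space[OF \<mu>] B by (intro integral_mono) auto
  also have "\<dots> = B" using \<mu> haar_space[OF \<mu>] by (simp add: haar_measure_on_def measure_def)
  finally show ?thesis .
qed

text \<open>
  Let \<open>T\<close> be a matrix of polynomials that approximates \<open>\<pi>\<close> uniformly on the group. Then
  \<open>B(s) = \<integral> T(s u) \<pi>(u\<inverse>) du\<close> is polynomial in \<open>s\<close>, and the substitution \<open>u \<mapsto> s\<inverse> u\<close> gives \<open>B(s) = A \<pi>(s)\<close>
  for \<open>A = \<integral> T(u) \<pi>(u\<inverse>) du\<close>. As \<open>T\<close> is close to \<open>\<pi>\<close>, the matrix \<open>A\<close> is close to the identity, hence
  invertible, and \<open>\<pi> = A\<inverse> B\<close> is polynomial. On the group the inverse of \<open>u\<close> is its transpose.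
\<close>

theorem representation_entries_polynomial:
  fixes \<mu> :: "(real^'n^'n) measure" and \<pi> :: "real^'n^'n \<Rightarrow> complex mat"
  assumes \<mu>: "haar_measure_on SO \<mu>" and rep: "continuous_rep SO d \<pi>" and ij: "i < d" "j < d"
  obtains F where "F \<in> matrix_polys" "\<And>x. x \<in> SO \<Longrightarrow> \<pi> x $$ (i, j) = F x"
proof -
  define w where "w = (\<lambda>i j x. \<pi> x $$ (i, j))"
  have cw: "continuous_on SO (w i j)" if "i < d" "j < d" for i j
    using rep that by (simp add: continuous_rep_def w_def)
  have wmult: "w i j (x ** y) = (\<Sum>k<d. w i k x * w k j y)" if "x \<in> SO" "y \<in> SO" "i < d" "j < d" for i j x y
  proof -
    have "\<pi> x \<in> carrier_mat d d" "\<pi> y \<in> carrier_mat d d" "\<pi> (x ** y) = \<pi> x * \<pi> y"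
      using rep that by (auto simp: continuous_rep_def)
    then show ?thesis using that by (simp add: w_def scalar_prod_def atLeast0LessThan)
  qed
  have wone: "w i j (mat 1) = (if i = j then 1 else 0)" if "i < d" "j < d" for i j
    using rep that by (simp add: continuous_rep_def w_def)
  have "bounded (\<Union>i<d. \<Union>j<d. w i j ` SO)"
    by (intro bounded_UN) (auto intro!: compact_imp_bounded compact_continuous_image cw compact_SO)
  then obtain C0 where "\<forall>y\<in>(\<Union>i<d. \<Union>j<d. w i j ` SO). cmod y \<le> C0"
    unfolding bounded_iff ..
  then have C0: "cmod (w i j x) \<le> C0" if "i < d" "j < d" "x \<in> SO" for i j x
    using that by auto
  define C where "C = max 1 C0"
  have C: "cmod (w i j x) \<le> C" if "i < d" "j < d" "x \<in> SO" for i j x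
    using C0[OF that] by (simp add: C_def)
  have d: "d > 0" and Cpos: "C > 0" using ij by (auto simp: C_def)
  \<comment> \<open>Chosen so that each row of \<open>A\<close> minus the identity has absolute sum at most \<open>1 / 2\<close>.\<close>
  define \<epsilon> where "\<epsilon> = 1 / (2 * real d * real d * C)"
  have "\<epsilon> > 0" using d Cpos by (simp add: \<epsilon>_def)
  have "\<exists>F\<in>matrix_polys. \<forall>x\<in>SO. cmod (F x - w r k x) < \<epsilon>" if "r < d" "k < d" for r k
    by (rule matrix_polys_dense[OF compact_SO cw[OF that] \<open>\<epsilon> > 0\<close>]) auto
  then have "\<forall>r k. \<exists>F. r < d \<longrightarrow> k < d \<longrightarrow> F \<in> matrix_polys \<and> (\<forall>x\<in>SO. cmod (F x - w r k x) < \<epsilon>)"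
    by blast
  then obtain T where "\<forall>r k. r < d \<longrightarrow> k < d \<longrightarrow> T r k \<in> matrix_polys \<and> (\<forall>x\<in>SO. cmod (T r k x - w r k x) < \<epsilon>)"
    unfolding choice_iff by blast
  then have T: "\<And>r k. r < d \<Longrightarrow> k < d \<Longrightarrow> T r k \<in> matrix_polys"
    "\<And>r k x. r < d \<Longrightarrow> k < d \<Longrightarrow> x \<in> SO \<Longrightarrow> cmod (T r k x - w r k x) < \<epsilon>"
    by auto
  have ct: "continuous_on SO (\<lambda>u :: real^'n^'n. transpose u)"
    unfolding transpose_def by (intro continuous_intros continuous_on_vec_lambda)
  have cwt: "continuous_on SO (\<lambda>u. w k c (transpose u))" if "k < d" "c < d" for k c
    by (rule continuous_on_compose2[OF cw[OF that] ct]) (auto intro: SO_transpose)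
  have cT: "continuous_on SO (T r k)" if "r < d" "k < d" for r k
    by (intro matrix_polys_continuous_on T that)
  define A where "A = (\<lambda>r c. LINT u|\<mu>. (\<Sum>k<d. T r k u * w k c (transpose u)))"
  define B where "B = (\<lambda>r c s. LINT u|\<mu>. (\<Sum>k<d. T r k (s ** u) * w k c (transpose u)))"
  have A_near: "cmod (A r c - (if r = c then 1 else 0)) \<le> real d * (\<epsilon> * C)" if rc: "r < d" "c < d" for r c
  proof -
    have one: "(\<Sum>k<d. w r k u * w k c (transpose u)) = (if r = c then 1 else 0)" if "u \<in> SO" for u
      using wmult[OF that SO_transpose[OF that] rc] wone[OF rc] by (simp add: SO_inverse[OF that])
    have "(LINT u|\<mu>. (\<Sum>k<d. w r k u * w k c (transpose u))) = (LINT u|\<mu>. (if r = c then 1 else 0))"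
      by (intro Bochner_Integration.integral_cong) (auto simp: haar_space[OF \<mu>] one)
    also have "\<dots> = (if r = c then 1 else 0)"
      using \<mu> haar_space[OF \<mu>] by (simp add: haar_measure_on_def measure_def)
    finally have "A r c - (if r = c then 1 else 0) =
        (LINT u|\<mu>. (\<Sum>k<d. T r k u * w k c (transpose u))) - (LINT u|\<mu>. (\<Sum>k<d. w r k u * w k c (transpose u)))"
      by (simp add: A_def)
    also have "\<dots> = (LINT u|\<mu>. (\<Sum>k<d. T r k u * w k c (transpose u)) - (\<Sum>k<d. w r k u * w k c (transpose u)))"
      by (rule Bochner_Integration.integral_diff[symmetric])
        (auto intro!: haar_integrable[OF \<mu>] continuous_on_sum continuous_on_mult cT cw cwt rc)
    finally have eq: "A r c - (if r = c then 1 else 0) = \<dots>" .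
    show ?thesis
      unfolding eq
    proof (rule haar_integral_norm_bound[OF \<mu>])
      show "continuous_on SO (\<lambda>u. (\<Sum>k<d. T r k u * w k c (transpose u)) - (\<Sum>k<d. w r k u * w k c (transpose u)))"
        by (auto intro!: continuous_on_diff continuous_on_sum continuous_on_mult cT cw cwt rc)
      fix u :: "real^'n^'n" assume u: "u \<in> SO"
      have "cmod ((\<Sum>k<d. T r k u * w k c (transpose u)) - (\<Sum>k<d. w r k u * w k c (transpose u))) =
          cmod (\<Sum>k<d. (T r k u - w r k u) * w k c (transpose u))"
        by (simp add: sum_subtractf left_diff_distrib)
      also have "\<dots> \<le> (\<Sum>k<d. \<epsilon> * C)"
        unfolding norm_mult
        by (intro order_trans[OF norm_sum] sum_mono, unfold norm_mult, intro mult_mono C)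
          (use rc T(2)[OF rc(1) _ u] u in \<open>auto intro: less_imp_le SO_transpose simp: \<open>\<epsilon> > 0\<close>\<close>)
      finally show "cmod ((\<Sum>k<d. T r k u * w k c (transpose u)) - (\<Sum>k<d. w r k u * w k c (transpose u))) \<le> real d * (\<epsilon> * C)"
        by simp
    qed
  qed
  have B_poly: "B r c \<in> matrix_polys" if rc: "r < d" "c < d" for r c
  proof -
    have int: "(\<lambda>s. LINT u|\<mu>. T r k (s ** u) * w k c (transpose u)) \<in> matrix_polys"
        "\<And>s. integrable \<mu> (\<lambda>u. T r k (s ** u) * w k c (transpose u))" if k: "k < d" for k
    proof -
      obtain R a b where ab: "\<And>q. q < R \<Longrightarrow> a q \<in> matrix_polys" "\<And>q. q < (R::nat) \<Longrightarrow> b q \<in> matrix_polys"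
        "\<And>A B. T r k (A ** B) = (\<Sum>q<R. a q A * b q B)"
        by (rule matrix_polys_separate[OF T(1)[OF rc(1) k]]) (rule that)
      have int: "integrable \<mu> (\<lambda>u. b q u * w k c (transpose u))" if "q < R" for q
        by (intro haar_integrable[OF \<mu>] continuous_on_mult matrix_polys_continuous_on ab(2) cwt that k rc)
      have eq: "T r k (s ** u) * w k c (transpose u) = (\<Sum>q<R. a q s * (b q u * w k c (transpose u)))" for s u
        by (simp add: ab(3) sum_distrib_right mult.assoc)
      have "(LINT u|\<mu>. T r k (s ** u) * w k c (transpose u)) = (\<Sum>q<R. a q s * (LINT u|\<mu>. b q u * w k c (transpose u)))" for s
        unfolding eq using int by (subst Bochner_Integration.integral_sum) auto
      moreover have "(\<lambda>s. \<Sum>q<R. a q s * (LINT u|\<mu>. b q u * w k c (transpose u))) \<in> matrix_polys"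
        by (intro matrix_polys_sum matrix_polys.mult matrix_polys.const ab(1)) simp
      ultimately show "(\<lambda>s. LINT u|\<mu>. T r k (s ** u) * w k c (transpose u)) \<in> matrix_polys" by simp
      show "integrable \<mu> (\<lambda>u. T r k (s ** u) * w k c (transpose u))" for s
        unfolding eq using int by auto
    qed
    have "B r c = (\<lambda>s. \<Sum>k<d. LINT u|\<mu>. T r k (s ** u) * w k c (transpose u))"
      unfolding B_def using int(2) by (intro ext Bochner_Integration.integral_sum) simp
    then show ?thesis by (simp only:) (rule matrix_polys_sum, simp add: int(1))
  qed
  \<comment> \<open>This is \<open>B(s) = A \<pi>(s)\<close>; as a function of \<open>y = s u\<close> the integrand is \<open>T(y) \<pi>(y\<inverse> s)\<close>.\<close>
  have B_eq: "B r c s = (\<Sum>q<d. A r q * w q c s)" if s: "s \<in> SO" and rc: "r < d" "c < d" for r c s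
  proof -
    define F where "F = (\<lambda>y. \<Sum>k<d. T r k y * w k c (transpose y ** s))"
    have F_eq: "F y = (\<Sum>q<d. (\<Sum>k<d. T r k y * w k q (transpose y)) * w q c s)" if "y \<in> SO" for y
    proof -
      have "F y = (\<Sum>k<d. \<Sum>q<d. T r k y * w k q (transpose y) * w q c s)"
        unfolding F_def using wmult[OF SO_transpose[OF that] s] rc
        by (intro sum.cong) (auto simp: sum_distrib_left mult.assoc)
      also have "\<dots> = (\<Sum>q<d. \<Sum>k<d. T r k y * w k q (transpose y) * w q c s)" by (rule sum.swap)
      finally show ?thesis by (simp add: sum_distrib_right)
    qed
    have cF: "continuous_on SO F"
      unfolding F_def
      by (intro continuous_on_sum continuous_on_mult cT rc continuous_on_compose2[OF cw]
          continuous_on_matrix_mult ct continuous_on_const)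
        (use rc s in \<open>auto intro: SO_mult SO_transpose\<close>)
    have "F (s ** u) = (\<Sum>k<d. T r k (s ** u) * w k c (transpose u))" for u
      unfolding F_def
      by (simp add: matrix_transpose_mul SO_inverse[OF s] flip: matrix_mul_assoc)
    then have "B r c s = (LINT u|\<mu>. F (s ** u))" by (simp add: B_def)
    also have "\<dots> = (LINT y|\<mu>. F y)" by (rule haar_invariant[OF \<mu> cF s])
    also have "\<dots> = (LINT y|\<mu>. (\<Sum>q<d. (\<Sum>k<d. T r k y * w k q (transpose y)) * w q c s))"
      by (rule Bochner_Integration.integral_cong) (auto simp: haar_space[OF \<mu>] F_eq)
    also have "\<dots> = (\<Sum>q<d. A r q * w q c s)"
    proof -
      have "integrable \<mu> (\<lambda>y. \<Sum>k<d. T r k y * w k q (transpose y))" if "q < d" for q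
        by (intro haar_integrable[OF \<mu>] continuous_on_sum continuous_on_mult cT cwt) (use rc that in auto)
      then show ?thesis
        unfolding A_def by (subst Bochner_Integration.integral_sum) auto
    qed
    finally show ?thesis .
  qed
  have "(\<Sum>c<d. cmod (Matrix.mat d d (\<lambda>(r, c). A r c) $$ (r, c) - (if r = c then 1 else 0))) < 1" if "r < d" for r
  proof -
    have "(\<Sum>c<d. cmod (Matrix.mat d d (\<lambda>(r, c). A r c) $$ (r, c) - (if r = c then 1 else 0))) \<le> (\<Sum>c<d. real d * (\<epsilon> * C))"
      using A_near that by (intro sum_mono) auto
    also have "\<dots> = 1 / 2" using d Cpos by (simp add: \<epsilon>_def field_simps)
    finally show ?thesis by simp
  qed
  then obtain A' where A': "A' \<in> carrier_mat d d" "A' * Matrix.mat d d (\<lambda>(r, c). A r c) = 1\<^sub>m d"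
    by (rule near_identity_left_inverse[OF mat_carrier]) auto
  have inv: "(\<Sum>r<d. A' $$ (i, r) * A r q) = (if i = q then 1 else 0)" if "q < d" for q
  proof -
    have "(A' * Matrix.mat d d (\<lambda>(r, c). A r c)) $$ (i, q) = (\<Sum>r<d. A' $$ (i, r) * A r q)"
      using A'(1) ij that by (simp add: scalar_prod_def atLeast0LessThan)
    then show ?thesis using A'(2) ij that by simp
  qed
  show thesis
  proof (rule that[of "\<lambda>s. \<Sum>r<d. A' $$ (i, r) * B r j s"])
    show "(\<lambda>s. \<Sum>r<d. A' $$ (i, r) * B r j s) \<in> matrix_polys"
      using ij by (intro matrix_polys_sum matrix_polys.mult matrix_polys.const B_poly) auto
    fix x :: "real^'n^'n" assume x: "x \<in> SO"
    have "(\<Sum>r<d. A' $$ (i, r) * B r j x) = (\<Sum>r<d. \<Sum>q<d. A' $$ (i, r) * A r q * w q j x)"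
      using B_eq[OF x _ ij(2)] by (intro sum.cong) (auto simp: sum_distrib_left mult.assoc)
    also have "\<dots> = (\<Sum>q<d. (\<Sum>r<d. A' $$ (i, r) * A r q) * w q j x)"
      by (subst sum.swap) (simp add: sum_distrib_right)
    also have "\<dots> = (\<Sum>q<d. (if i = q then 1 else 0) * w q j x)"
      by (intro sum.cong) (auto simp: inv)
    also have "\<dots> = w i j x"
      using ij by (simp add: if_distrib[of "\<lambda>x. x * _"] cong: if_cong)
    finally show "\<pi> x $$ (i, j) = (\<Sum>r<d. A' $$ (i, r) * B r j x)" by (simp add: w_def)
  qed
qed

corollary finite_type_polynomial:
  fixes \<mu> :: "(real^'n^'n) measure" and f :: "real^'n^'n \<Rightarrow> complex"
  assumes \<mu>: "haar_measure_on SO \<mu>" and f: "finite_type SO f"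
  obtains F where "F \<in> matrix_polys" "\<And>x. x \<in> SO \<Longrightarrow> f x = F x"
proof -
  obtain M :: nat and d \<pi> a where
    rep: "\<forall>m<M. irreducible_continuous_rep SO (d m) (\<pi> m) \<and> a m \<in> carrier_mat (d m) (d m)"
    and f_eq: "\<forall>x\<in>SO. f x = (\<Sum>m<M. mat_trace (a m * \<pi> m x))"
    using f unfolding finite_type_def by blast
  have rep: "continuous_rep SO (d m) (\<pi> m)" "a m \<in> carrier_mat (d m) (d m)" if "m < M" for m
    using rep that by (auto simp: irreducible_continuous_rep_def)
  have "\<exists>F\<in>matrix_polys. \<forall>x\<in>SO. \<pi> m x $$ (i, j) = F x" if "m < M" "i < d m" "j < d m" for m i j
    by (rule representation_entries_polynomial[OF \<mu> rep(1)[OF that(1)] that(2,3)]) auto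
  then have "\<forall>m i j. \<exists>F. m < M \<longrightarrow> i < d m \<longrightarrow> j < d m \<longrightarrow> F \<in> matrix_polys \<and> (\<forall>x\<in>SO. \<pi> m x $$ (i, j) = F x)"
    by blast
  then obtain P where "\<forall>m i j. m < M \<longrightarrow> i < d m \<longrightarrow> j < d m \<longrightarrow>
      P m i j \<in> matrix_polys \<and> (\<forall>x\<in>SO. \<pi> m x $$ (i, j) = P m i j x)"
    unfolding choice_iff by blast
  then have P: "\<And>m i j. m < M \<Longrightarrow> i < d m \<Longrightarrow> j < d m \<Longrightarrow> P m i j \<in> matrix_polys"
    "\<And>m i j x. m < M \<Longrightarrow> i < d m \<Longrightarrow> j < d m \<Longrightarrow> x \<in> SO \<Longrightarrow> \<pi> m x $$ (i, j) = P m i j x"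
    by auto
  show thesis
  proof (rule that[of "\<lambda>x. \<Sum>m<M. \<Sum>i<d m. \<Sum>k<d m. a m $$ (i, k) * P m k i x"])
    show "(\<lambda>x. \<Sum>m<M. \<Sum>i<d m. \<Sum>k<d m. a m $$ (i, k) * P m k i x) \<in> matrix_polys"
      by (intro matrix_polys_sum matrix_polys.mult matrix_polys.const P) auto
    fix x :: "real^'n^'n" assume x: "x \<in> SO"
    have "mat_trace (a m * \<pi> m x) = (\<Sum>i<d m. \<Sum>k<d m. a m $$ (i, k) * P m k i x)" if "m < M" for m
    proof -
      have "\<pi> m x \<in> carrier_mat (d m) (d m)" using rep(1)[OF that] x by (simp add: continuous_rep_def)
      then show ?thesis using rep(2)[OF that] P(2)[OF that _ _ x]
        by (simp add: mat_trace_def scalar_prod_def atLeast0LessThan)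
    qed
    then show "f x = (\<Sum>m<M. \<Sum>i<d m. \<Sum>k<d m. a m $$ (i, k) * P m k i x)"
      using f_eq x by simp
  qed
qed

section \<open>Euler coordinates\<close>

lemma plane_averages_separated_at:
  fixes F :: "real^'n^'n \<Rightarrow> complex" and R :: nat
  assumes "\<And>r. r < R \<Longrightarrow> a r \<in> matrix_polys"
    and "\<And>A. F (A ** M) = (\<Sum>r<R. a r A * (b r :: complex))"
  shows "foldr (plane_average e) ps F (A ** M) = (\<Sum>r<R. foldr (plane_average e) ps (a r) A * b r)"
proof (induction ps arbitrary: A)
  case (Cons p ps)
  show ?case
    by (simp add: plane_average_separated_at[OF plane_averages_matrix_poly[OF assms(1)] Cons.IH])
qed (simp add: assms(2))

text \<open>
  The sequence of plane rotations, each as a pair of a plane and the index of its variable. A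
  rotation in the first plane of the block of size \<open>n\<close> uses \<open>z\<^bsub>n-1\<^esub>\<close>, and the one in a plane
  \<open>p \<ge> 2\<close> uses \<open>x\<^bsub>s+p-1\<^esub>\<close>, where \<open>s\<close> counts the \<open>x\<close>-variables of the earlier blocks. This is the
  numbering that the recursion for the weight \<open>J_SO\<close> prescribes.
\<close>

fun euler_word :: "nat \<Rightarrow> nat \<Rightarrow> (nat \<times> nat) list" where
  "euler_word 0 s = []"
| "euler_word (Suc n) s =
     map (\<lambda>p. (p, if p = 1 then n else s + p - 1)) [1..<Suc n] @ euler_word n (s + (n - 1))"

text \<open>
  The point on the unit circle whose argument is the rotation angle: for \<open>x = cos \<theta>\<close> with
  \<open>\<theta> \<in> [0, \<pi>]\<close> it is \<open>x + i sqrt (1 - x\<^sup>2)\<close>. Treating both kinds of variables as points of the circle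
  avoids distinguishing them until the integrals are evaluated.
\<close>

definition circle_coord :: "(nat \<Rightarrow> real) \<Rightarrow> (nat \<Rightarrow> complex) \<Rightarrow> nat \<times> nat \<Rightarrow> complex" where
  "circle_coord x z i =
     (if fst i = 1 then z (snd i) else Complex (x (snd i)) (sqrt (1 - (x (snd i))\<^sup>2)))"

definition unit_givens :: "(nat \<Rightarrow> 'n) \<Rightarrow> nat \<Rightarrow> complex \<Rightarrow> real^'n^'n" where
  "unit_givens e p \<zeta> = givens (e p) (e (Suc p)) (Re \<zeta>) (Im \<zeta>)"

text \<open>
  The first rotation of the word is the rightmost factor, in accordance with \<open>plane_average\<close>, which
  translates the argument from the left.
\<close>

fun euler_product ::
    "(nat \<Rightarrow> 'n::finite) \<Rightarrow> (nat \<times> nat) list \<Rightarrow> (nat \<Rightarrow> real) \<Rightarrow> (nat \<Rightarrow> complex) \<Rightarrow> real^'n^'n" where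
  "euler_product e [] x z = mat 1"
| "euler_product e (i # w) x z =
     euler_product e w x z ** unit_givens e (fst i) (circle_coord x z i)"

definition angle_integral :: "nat \<times> nat \<Rightarrow> (complex \<Rightarrow> complex) \<Rightarrow> complex" where
  "angle_integral i u = integral {0..angle_bound (fst i)}
     (\<lambda>t. complex_of_real (sin t ^ (fst i - 1)) * u (cis t))"

text \<open>
  The function \<open>f\<close> is a sum of products of functions of one variable, and \<open>V\<close> is its weighted integral
  over all angles, computed factor by factor. In this form an integral over a product space
  and an iterated average can be compared by evaluating both.
\<close>

definition separable_along ::
    "(nat \<times> nat) list \<Rightarrow> ((nat \<Rightarrow> real) \<Rightarrow> (nat \<Rightarrow> complex) \<Rightarrow> complex) \<Rightarrow> complex \<Rightarrow> bool" where
  "separable_along w f V \<longleftrightarrow> (\<exists>(R::nat) c u.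
     (\<forall>r<R. \<forall>i\<in>set w. continuous_on (sphere 0 1) (u r i)) \<and>
     (\<forall>x z. f x z = (\<Sum>r<R. c r * (\<Prod>i\<leftarrow>w. u r i (circle_coord x z i)))) \<and>
     V = (\<Sum>r<R. c r * (\<Prod>i\<leftarrow>w. angle_integral i (u r i))))"

lemma separable_along_zero: "separable_along w (\<lambda>x z. 0) 0"
  unfolding separable_along_def by (rule exI[of _ 0]) simp

lemma sum_lessThan_append:
  fixes f g :: "nat \<Rightarrow> 'a::comm_monoid_add"
  shows "(\<Sum>r<m + n. if r < m then f r else g (r - m)) = (\<Sum>r<m. f r) + (\<Sum>r<n. g r)"
  by (induction n) (simp_all add: add.assoc)

lemma separable_along_add:
  assumes "separable_along w f V" "separable_along w g W"
  shows "separable_along w (\<lambda>x z. f x z + g x z) (V + W)"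
proof -
  obtain R c u where f: "\<forall>r<R. \<forall>i\<in>set w. continuous_on (sphere 0 1) (u r i)"
    "\<forall>x z. f x z = (\<Sum>r<R::nat. c r * (\<Prod>i\<leftarrow>w. u r i (circle_coord x z i)))"
    "V = (\<Sum>r<R. c r * (\<Prod>i\<leftarrow>w. angle_integral i (u r i)))"
    using assms(1) unfolding separable_along_def by blast
  obtain R' c' u' where g: "\<forall>r<R'. \<forall>i\<in>set w. continuous_on (sphere 0 1) (u' r i)"
    "\<forall>x z. g x z = (\<Sum>r<R'::nat. c' r * (\<Prod>i\<leftarrow>w. u' r i (circle_coord x z i)))"
    "W = (\<Sum>r<R'. c' r * (\<Prod>i\<leftarrow>w. angle_integral i (u' r i)))"
    using assms(2) unfolding separable_along_def by blast
  define C where "C r = (if r < R then c r else c' (r - R))" for r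
  define U where "U r = (if r < R then u r else u' (r - R))" for r
  show ?thesis
    unfolding separable_along_def
  proof (intro exI[of _ "R + R'"] exI[of _ C] exI[of _ U] conjI allI impI ballI)
    show "continuous_on (sphere 0 1) (U r i)" if "r < R + R'" "i \<in> set w" for r i
      using f(1) g(1) that by (auto simp: U_def)
    have key: "(\<Sum>r<R + R'. C r * (\<Prod>i\<leftarrow>w. h i (U r i))) =
        (\<Sum>r<R. c r * (\<Prod>i\<leftarrow>w. h i (u r i))) + (\<Sum>r<R'. c' r * (\<Prod>i\<leftarrow>w. h i (u' r i)))" for h
      unfolding sum_lessThan_append[symmetric] by (intro sum.cong) (auto simp: C_def U_def)
    show "f x z + g x z = (\<Sum>r<R + R'. C r * (\<Prod>i\<leftarrow>w. U r i (circle_coord x z i)))"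
      "V + W = (\<Sum>r<R + R'. C r * (\<Prod>i\<leftarrow>w. angle_integral i (U r i)))" for x z
      using f(2,3) g(2,3) key[of "\<lambda>i g. g (circle_coord x z i)"] key[of angle_integral] by simp_all
  qed
qed

lemma separable_along_sum:
  assumes "\<And>q. q < Q \<Longrightarrow> separable_along w (f q) (V q)"
  shows "separable_along w (\<lambda>x z. \<Sum>q<Q. f q x z) (\<Sum>q<(Q::nat). V q)"
  using assms
  by (induction Q) (simp_all add: separable_along_zero separable_along_add)

lemma separable_along_Cons:
  assumes "separable_along w f V" "i \<notin> set w" "continuous_on (sphere 0 1) \<beta>"
  shows "separable_along (i # w) (\<lambda>x z. f x z * \<beta> (circle_coord x z i)) (V * angle_integral i \<beta>)"
proof -
  obtain R c u where f: "\<forall>r<R. \<forall>i\<in>set w. continuous_on (sphere 0 1) (u r i)"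
    "\<forall>x z. f x z = (\<Sum>r<R::nat. c r * (\<Prod>i\<leftarrow>w. u r i (circle_coord x z i)))"
    "V = (\<Sum>r<R. c r * (\<Prod>i\<leftarrow>w. angle_integral i (u r i)))"
    using assms(1) unfolding separable_along_def by blast
  have upd: "(\<Prod>j\<leftarrow>w. h j (((u r)(i := \<beta>)) j)) = (\<Prod>j\<leftarrow>w. h j (u r j))" for r and h :: "_ \<Rightarrow> _ \<Rightarrow> complex"
    using assms(2) by (intro arg_cong[where f = prod_list] map_cong) auto
  show ?thesis
    unfolding separable_along_def
  proof (intro exI[of _ R] exI[of _ c] exI[of _ "\<lambda>r. (u r)(i := \<beta>)"] conjI allI impI ballI)
    show "continuous_on (sphere 0 1) (((u r)(i := \<beta>)) j)" if "r < R" "j \<in> set (i # w)" for r j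
      using f(1) assms(3) that by auto
    show "f x z * \<beta> (circle_coord x z i) = (\<Sum>r<R. c r * (\<Prod>j\<leftarrow>i # w. ((u r)(i := \<beta>)) j (circle_coord x z j)))" for x z
      using upd[of "\<lambda>j g. g (circle_coord x z j)"] f(2)
      by (simp add: sum_distrib_left mult_ac)
    show "V * angle_integral i \<beta> = (\<Sum>r<R. c r * (\<Prod>j\<leftarrow>i # w. angle_integral j (((u r)(i := \<beta>)) j)))"
      using upd[of angle_integral] f(3)
      by (simp add: sum_distrib_left mult_ac)
  qed
qed

lemma euler_product_separable:
  fixes F :: "real^'n^'n \<Rightarrow> complex"
  assumes "distinct w" "F \<in> matrix_polys"
  shows "separable_along w (\<lambda>x z. F (euler_product e w x z)) (foldr (plane_average e) (map fst w) F (mat 1))"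
  using assms
proof (induction w arbitrary: F)
  case Nil
  show ?case
    unfolding separable_along_def
    by (rule exI[of _ 1], rule exI[of _ "\<lambda>_. F (mat 1)"]) auto
next
  case (Cons i w)
  obtain R a b where ab: "\<And>r. r < R \<Longrightarrow> a r \<in> matrix_polys" "\<And>r. r < (R::nat) \<Longrightarrow> b r \<in> matrix_polys"
    "\<And>A B. F (A ** B) = (\<Sum>r<R. a r A * b r B)"
    by (rule matrix_polys_separate[OF Cons.prems(2)]) (rule that)
  let ?T = "foldr (plane_average e) (map fst w)"
  have cont: "continuous_on (sphere 0 1) (\<lambda>\<zeta>. b r (unit_givens e (fst i) \<zeta>))" if "r < R" for r
    unfolding unit_givens_def
    by (rule continuous_on_compose2[OF matrix_polys_continuous_on[OF ab(2)[OF that], of UNIV]])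
      (auto intro!: continuous_intros)
  have ang: "angle_integral i (\<lambda>\<zeta>. b r (unit_givens e (fst i) \<zeta>)) = plane_average e (fst i) (b r) (mat 1)" for r
    by (simp add: angle_integral_def unit_givens_def plane_average_def)
  have "separable_along (i # w)
      (\<lambda>x z. \<Sum>r<R. a r (euler_product e w x z) * b r (unit_givens e (fst i) (circle_coord x z i)))
      (\<Sum>r<R. ?T (a r) (mat 1) * angle_integral i (\<lambda>\<zeta>. b r (unit_givens e (fst i) \<zeta>)))"
    using Cons.prems(1) Cons.IH ab(1) cont
    by (intro separable_along_sum separable_along_Cons[where \<beta> = "\<lambda>\<zeta>. b r (unit_givens e (fst i) \<zeta>)" for r]) auto
  moreover have "foldr (plane_average e) (map fst (i # w)) F (mat 1) =
      (\<Sum>r<R. plane_average e (fst i) (b r) (mat 1) * ?T (a r) (mat 1))"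
  proof -
    have "?T F (A ** mat 1) = (\<Sum>r<R. b r A * ?T (a r) (mat 1))" for A
      using plane_averages_separated_at[OF ab(1,3), of e "map fst w" "mat 1" A] by (simp add: mult.commute)
    from plane_average_separated[OF ab(2) this] show ?thesis by simp
  qed
  ultimately show ?case by (simp add: ab(3) ang mult.commute)
qed

lemma map_fst_euler_word: "map fst (euler_word n s) = euler_planes n"
  by (induction n arbitrary: s) (auto simp: o_def)

lemma euler_word_mem:
  "(p, v) \<in> set (euler_word n s) \<Longrightarrow>
    (p = 1 \<and> 1 \<le> v \<and> v < n) \<or> (2 \<le> p \<and> p < n \<and> s < v \<and> v \<le> s + (n - 1) * (n - 2) div 2)"
proof (induction n arbitrary: s)
  case (Suc n)
  have tri: "n * (n - 1) div 2 = (n - 1) + (n - 1) * (n - 2) div 2"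
  proof (cases n)
    case (Suc m)
    then show ?thesis by (cases m) (auto simp: algebra_simps)
  qed simp
  define t where "t = (n - 1) * (n - 2) div 2"
  have t: "(Suc n - 1) * (Suc n - 2) div 2 = (n - 1) + t"
    using tri by (simp add: t_def)
  show ?case
    unfolding t
  proof (cases "(p, v) \<in> set (euler_word n (s + (n - 1)))")
    case True
    from Suc.IH[OF True, folded t_def]
    show "(p = 1 \<and> 1 \<le> v \<and> v < Suc n) \<or> (2 \<le> p \<and> p < Suc n \<and> s < v \<and> v \<le> s + (n - 1 + t))"
      by linarith
  next
    case False
    then have "p \<in> {1..<Suc n}" "v = (if p = 1 then n else s + p - 1)" using Suc.prems by auto
    then show "(p = 1 \<and> 1 \<le> v \<and> v < Suc n) \<or> (2 \<le> p \<and> p < Suc n \<and> s < v \<and> v \<le> s + (n - 1 + t))"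
      by (auto split: if_splits)
  qed
qed simp

lemma distinct_euler_word: "distinct (euler_word n s)"
proof (induction n arbitrary: s)
  case (Suc n)
  have "(p, if p = 1 then n else s + p - 1) \<notin> set (euler_word n (s + (n - 1)))" if "p \<le> n" for p
    using euler_word_mem[of p "if p = 1 then n else s + p - 1" n "s + (n - 1)"] that by auto
  then show ?case using Suc by (auto simp: distinct_map inj_on_def)
qed simp


text \<open>
  Each \<open>z\<^sub>j\<close> and each \<open>x\<^sub>v\<close> occurs in exactly one rotation, which turns a product along the word into a
  product over the coordinates. The plane \<open>pl v\<close> of the variable \<open>x\<^sub>v\<close> also determines its exponent in
  the weight. Starting at an arbitrary offset \<open>s\<close> makes the recursion of \<open>J_SO\<close>, which shifts the
  variables, accessible to induction.
\<close>

lemma euler_word_structure: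
  assumes "1 \<le> n"
  shows "\<exists>pl. (\<forall>v. 2 \<le> pl v) \<and>
    (\<forall>f::nat \<times> nat \<Rightarrow> complex. (\<Prod>i\<leftarrow>euler_word n s. f i) =
       (\<Prod>j\<in>{1..n - 1}. f (1, j)) * (\<Prod>v\<in>{s<..s + (n - 1) * (n - 2) div 2}. f (pl v, v))) \<and>
    (\<exists>C>0. \<forall>x. J_SO n (\<lambda>i. x (i + s)) =
       C * (\<Prod>v\<in>{s<..s + (n - 1) * (n - 2) div 2}. sqrt (1 - (x v)\<^sup>2) ^ (pl v - 2)))"
  using assms
proof (induction n arbitrary: s rule: nat_induct_at_least)
  case base
  show ?case
    by (intro exI[of _ "\<lambda>_. 2"] conjI allI) (auto simp: J_SO.simps intro!: exI[of _ 1])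
next
  case (Suc n)
  define t where "t = (n - 1) * (n - 2) div 2"
  have t: "(Suc n - 1) * (Suc n - 2) div 2 = (n - 1) + t"
  proof (cases n)
    case (Suc m)
    then show ?thesis by (cases m) (auto simp: t_def algebra_simps)
  qed (simp add: t_def)
  obtain pl C where pl: "\<And>v. 2 \<le> pl v"
    and word: "\<And>f::nat \<times> nat \<Rightarrow> complex. (\<Prod>i\<leftarrow>euler_word n (s + (n - 1)). f i) =
       (\<Prod>j\<in>{1..n - 1}. f (1, j)) * (\<Prod>v\<in>{s + (n - 1)<..s + (n - 1) + t}. f (pl v, v))"
    and J: "C > 0" "\<And>x. J_SO n (\<lambda>i. x (i + (s + (n - 1)))) =
       C * (\<Prod>v\<in>{s + (n - 1)<..s + (n - 1) + t}. sqrt (1 - (x v)\<^sup>2) ^ (pl v - 2))"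
    using Suc.IH[of "s + (n - 1)", folded t_def] by blast
  \<comment> \<open>The maximum with 2 only matters for \<open>v \<le> s\<close>, outside the range of the products.\<close>
  define pl' where "pl' v = (if v \<le> s + (n - 1) then max 2 (v - s + 1) else pl v)" for v
  have split: "{s<..s + (n - 1 + t)} = {s<..s + (n - 1)} \<union> {s + (n - 1)<..s + (n - 1) + t}" by auto
  have prod_split: "prod h {s<..s + (n - 1 + t)} =
      prod h {s<..s + (n - 1)} * prod h {s + (n - 1)<..s + (n - 1) + t}" for h :: "nat \<Rightarrow> 'a::comm_monoid_mult"
    unfolding split by (rule prod.union_disjoint) auto
  have shift: "prod h {s<..s + (n - 1)} = (\<Prod>j=1..n - 1. h (s + j))" for h :: "nat \<Rightarrow> 'a::comm_monoid_mult"
    by (rule prod.reindex_bij_witness[of _ "\<lambda>j. s + j" "\<lambda>v. v - s"]) auto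
  have tail: "(\<Prod>v\<in>{s + (n - 1)<..s + (n - 1) + t}. h (pl v) v) = (\<Prod>v\<in>{s + (n - 1)<..s + (n - 1) + t}. h (pl' v) v)"
    for h :: "nat \<Rightarrow> nat \<Rightarrow> 'a::comm_monoid_mult"
    by (intro prod.cong) (auto simp: pl'_def)
  have head: "(\<Prod>j=1..n - 1. h (pl' (s + j)) (s + j)) = (\<Prod>j=1..n - 1. h (Suc j) (s + j))"
    for h :: "nat \<Rightarrow> nat \<Rightarrow> 'a::comm_monoid_mult"
    by (intro prod.cong) (auto simp: pl'_def)
  show ?case
    unfolding t
  proof (intro exI[of _ pl'] conjI allI)
    show "2 \<le> pl' v" for v using pl by (simp add: pl'_def)
    show "(\<Prod>i\<leftarrow>euler_word (Suc n) s. f i) =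
        (\<Prod>j\<in>{1..Suc n - 1}. f (1, j)) * (\<Prod>v\<in>{s<..s + (n - 1 + t)}. f (pl' v, v))"
      for f :: "nat \<times> nat \<Rightarrow> complex"
    proof -
      have "(\<Prod>i\<leftarrow>map (\<lambda>p. (p, if p = 1 then n else s + p - 1)) [1..<Suc n]. f i) =
          (\<Prod>p\<in>{1..<Suc n}. f (p, if p = 1 then n else s + p - 1))"
        using prod.distinct_set_conv_list[of "[1..<Suc n]" "\<lambda>p. f (p, if p = 1 then n else s + p - 1)"]
        by (simp add: o_def del: upt_Suc)
      also have "{1..<Suc n} = insert 1 {2..n}" using Suc(1) by auto
      also have "(\<Prod>p\<in>\<dots>. f (p, if p = 1 then n else s + p - 1)) = f (1, n) * (\<Prod>p=2..n. f (p, s + p - 1))"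
        by simp
      also have "(\<Prod>p=2..n. f (p, s + p - 1)) = (\<Prod>j=1..n - 1. f (Suc j, s + j))"
        by (rule prod.reindex_bij_witness[of _ Suc "\<lambda>p. p - 1"]) auto
      also have "\<dots> = (\<Prod>v\<in>{s<..s + (n - 1)}. f (pl' v, v))"
        unfolding shift using head[of "\<lambda>p v. f (p, v)"] by simp
      finally have "(\<Prod>i\<leftarrow>euler_word (Suc n) s. f i) = f (1, n) * (\<Prod>v\<in>{s<..s + (n - 1)}. f (pl' v, v)) *
          ((\<Prod>j\<in>{1..n - 1}. f (1, j)) * (\<Prod>v\<in>{s + (n - 1)<..s + (n - 1) + t}. f (pl' v, v)))"
        using word[of f] tail[of "\<lambda>p v. f (p, v)"] by simp
      also have "\<dots> = ((\<Prod>j\<in>{1..n - 1}. f (1, j)) * f (1, n)) * (\<Prod>v\<in>{s<..s + (n - 1 + t)}. f (pl' v, v))"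
        unfolding prod_split by (simp add: mult_ac)
      also have "(\<Prod>j\<in>{1..n - 1}. f (1, j)) * f (1, n) = (\<Prod>j\<in>{1..Suc n - 1}. f (1, j))"
        using Suc(1) by (cases n) auto
      finally show ?thesis .
    qed
    show "\<exists>C>0. \<forall>x. J_SO (Suc n) (\<lambda>i. x (i + s)) =
        C * (\<Prod>v\<in>{s<..s + (n - 1 + t)}. sqrt (1 - (x v)\<^sup>2) ^ (pl' v - 2))"
    proof (cases "n = 1")
      case True
      then show ?thesis by (auto simp: t_def J_SO.simps intro!: exI[of _ 1])
    next
      case False
      let ?c = "Gamma (real (Suc n) / 2) / (2 * pi powr (real (Suc n) / 2))"
      have "J_SO (Suc n) (\<lambda>i. x (i + s)) =
          ?c * C * (\<Prod>v\<in>{s<..s + (n - 1 + t)}. sqrt (1 - (x v)\<^sup>2) ^ (pl' v - 2))" for x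
      proof -
        have "J_SO (Suc n) (\<lambda>i. x (i + s)) = ?c * (\<Prod>j=1..n - 1. sqrt (1 - (x (j + s))\<^sup>2) ^ (j - 1)) *
            J_SO n (\<lambda>i. x (i + (s + (n - 1))))"
        proof -
          have "\<not> Suc n \<le> 2" "Suc n - 2 = n - 1" "Suc n - 1 = n" "\<And>i. i + (n - 1) + s = i + (s + (n - 1))"
            using False Suc(1) by auto
          then show ?thesis by (subst J_SO.simps) (simp only: if_False)
        qed
        also have "(\<Prod>j=1..n - 1. sqrt (1 - (x (j + s))\<^sup>2) ^ (j - 1)) =
            (\<Prod>v\<in>{s<..s + (n - 1)}. sqrt (1 - (x v)\<^sup>2) ^ (pl' v - 2))"
          unfolding shift using head[of "\<lambda>p v. sqrt (1 - (x v)\<^sup>2) ^ (p - 2)"] by (simp add: add.commute)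
        also have "J_SO n (\<lambda>i. x (i + (s + (n - 1)))) =
            C * (\<Prod>v\<in>{s + (n - 1)<..s + (n - 1) + t}. sqrt (1 - (x v)\<^sup>2) ^ (pl' v - 2))"
          unfolding J(2) using tail[of "\<lambda>p v. sqrt (1 - (x v)\<^sup>2) ^ (p - 2)"] by simp
        finally show ?thesis unfolding prod_split by (simp add: mult_ac)
      qed
      moreover have "?c * C > 0" using J(1) by (simp add: Gamma_real_pos)
      ultimately show ?thesis by blast
    qed
  qed
qed

section \<open>Integration in Euler coordinates\<close>

lemma circle_contour_integral:
  assumes "continuous_on (sphere 0 1) v"
  shows "((\<lambda>w. v w / w) has_contour_integral \<i> * integral {0..2 * pi} (\<lambda>t. v (cis t))) (circlepath 0 1)"
proof -
  have "continuous_on {0..2 * pi} (\<lambda>t. v (cis t))"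
    by (rule continuous_on_compose2[OF assms]) (auto intro!: continuous_intros)
  then have "((\<lambda>t. \<i> * v (cis t)) has_integral \<i> * integral {0..2 * pi} (\<lambda>t. v (cis t))) {0..2 * pi}"
    by (intro has_integral_mult_right integrable_integral integrable_continuous_interval)
  then show ?thesis
    unfolding circlepath_def
    by (subst has_contour_integral_part_circlepath_iff) (simp_all add: mult.commute)
qed

lemma torus_integral_separated:
  fixes v :: "'r \<Rightarrow> nat \<Rightarrow> complex \<Rightarrow> complex"
  assumes "finite R" "\<And>r j. r \<in> R \<Longrightarrow> j \<in> {1..l} \<Longrightarrow> continuous_on (sphere 0 1) (v r j)"
  shows "torus_integral l (\<lambda>z. \<Sum>r\<in>R. c r * (\<Prod>j=1..l. v r j (z j))) =
    (\<Sum>r\<in>R. c r * (\<Prod>j=1..l. \<i> * integral {0..2 * pi} (\<lambda>t. v r j (cis t))))"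
  using assms(2)
proof (induction l arbitrary: c)
  case (Suc l)
  let ?I = "\<lambda>r j. \<i> * integral {0..2 * pi} (\<lambda>t. v r j (cis t))"
  have "contour_integral (circlepath 0 1)
      (\<lambda>w. (\<Sum>r\<in>R. c r * (\<Prod>j=1..Suc l. v r j ((z(Suc l := w)) j))) / w) =
      (\<Sum>r\<in>R. c r * ?I r (Suc l) * (\<Prod>j=1..l. v r j (z j)))" for z
  proof -
    have eq: "(\<Sum>r\<in>R. c r * (\<Prod>j=1..Suc l. v r j ((z(Suc l := w)) j))) / w =
        (\<Sum>r\<in>R. c r * (\<Prod>j=1..l. v r j (z j)) * (v r (Suc l) w / w))" for w
      by (simp add: sum_divide_distrib mult.assoc)
    have "((\<lambda>w. \<Sum>r\<in>R. c r * (\<Prod>j=1..l. v r j (z j)) * (v r (Suc l) w / w)) has_contour_integral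
        (\<Sum>r\<in>R. c r * (\<Prod>j=1..l. v r j (z j)) * ?I r (Suc l))) (circlepath 0 1)"
      using Suc.prems
      by (intro has_contour_integral_sum has_contour_integral_lmul circle_contour_integral assms(1)) auto
    then show ?thesis
      unfolding eq by (simp add: contour_integral_unique mult_ac)
  qed
  then have "torus_integral (Suc l) (\<lambda>z. \<Sum>r\<in>R. c r * (\<Prod>j=1..Suc l. v r j (z j))) =
      torus_integral l (\<lambda>z. \<Sum>r\<in>R. c r * ?I r (Suc l) * (\<Prod>j=1..l. v r j (z j)))"
    by simp
  also have "\<dots> = (\<Sum>r\<in>R. c r * ?I r (Suc l) * (\<Prod>j=1..l. ?I r j))"
    using Suc.prems by (intro Suc.IH) auto
  finally show ?case by (simp add: mult_ac)
qed simp

lemma torus_integral_cong: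
  assumes "\<And>z. z \<in> torus l \<Longrightarrow> F z = G z"
  shows "torus_integral l F = torus_integral l G"
  using assms
proof (induction l arbitrary: F G)
  case 0
  have "(\<lambda>_. undefined) \<in> torus 0" by (simp add: torus_def)
  then show ?case using 0 by simp
next
  case (Suc l)
  have "contour_integral (circlepath 0 1) (\<lambda>w. F (z(Suc l := w)) / w) =
      contour_integral (circlepath 0 1) (\<lambda>w. G (z(Suc l := w)) / w)" if "z \<in> torus l" for z
  proof (rule contour_integral_eq)
    fix w assume "w \<in> path_image (circlepath 0 1)"
    then have "w \<in> sphere 0 1" by simp
    then have "z(Suc l := w) \<in> torus (Suc l)"
      using that by (auto simp: torus_def PiE_iff extensional_def)
    then have "F (z(Suc l := w)) = G (z(Suc l := w))" by (rule Suc.prems)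
    then show "F (z(Suc l := w)) / w = G (z(Suc l := w)) / w" by (rule arg_cong)
  qed
  then show ?case unfolding torus_integral.simps by (rule Suc.IH)
qed

lemma space_cube_measure: "space (cube_measure k) = cube k"
  by (simp add: cube_measure_def cube_def space_PiM)

lemma interval_lebesgue_integral:
  fixes g :: "real \<Rightarrow> complex"
  assumes "continuous_on {-1..1} g"
  shows "integrable (restrict_space lborel {-1..1}) g"
    "(LINT x|restrict_space lborel {-1..1}. g x) = integral {-1..1} g"
proof -
  have "set_integrable lborel {-1..1} g" by (rule borel_integrable_atLeastAtMost'[OF assms])
  then show "integrable (restrict_space lborel {-1..1}) g"
    by (subst integrable_restrict_space) (auto simp: set_integrable_def)
  show "(LINT x|restrict_space lborel {-1..1}. g x) = integral {-1..1} g"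
    using set_borel_integral_eq_integral(2)[OF \<open>set_integrable lborel {-1..1} g\<close>]
    by (subst integral_restrict_space) (auto simp: set_lebesgue_integral_def)
qed

lemma cube_integral_prod:
  fixes g :: "nat \<Rightarrow> real \<Rightarrow> complex"
  assumes "\<And>v. v \<in> {1..k} \<Longrightarrow> continuous_on {-1..1} (g v)"
  shows "integrable (cube_measure k) (\<lambda>x. \<Prod>v=1..k. g v (x v))"
    "(LINT x|cube_measure k. (\<Prod>v=1..k. g v (x v))) = (\<Prod>v=1..k. integral {-1..1} (g v))"
proof -
  have "sigma_finite_measure (restrict_space lborel {-1..1::real})"
    by (rule sigma_finite_measure_restrict_space[OF lborel.sigma_finite_measure_axioms]) simp
  then interpret product_sigma_finite "\<lambda>_::nat. restrict_space lborel {-1..1::real}"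
    by (simp add: product_sigma_finite_def)
  show "integrable (cube_measure k) (\<lambda>x. \<Prod>v=1..k. g v (x v))"
    unfolding cube_measure_def
    by (rule product_integrable_prod) (auto intro!: interval_lebesgue_integral assms)
  have "(LINT x|cube_measure k. (\<Prod>v=1..k. g v (x v))) = (\<Prod>v=1..k. LINT x|restrict_space lborel {-1..1}. g v x)"
    unfolding cube_measure_def
    by (rule product_integral_prod) (auto intro!: interval_lebesgue_integral assms)
  also have "\<dots> = (\<Prod>v=1..k. integral {-1..1} (g v))"
  proof (rule prod.cong)
    fix v assume "v \<in> {1..k}"
    from interval_lebesgue_integral(2)[OF assms[OF this]]
    show "(LINT x|restrict_space lborel {-1..1}. g v x) = integral {-1..1} (g v)" .
  qed simp
  finally show "(LINT x|cube_measure k. (\<Prod>v=1..k. g v (x v))) = (\<Prod>v=1..k. integral {-1..1} (g v))" .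
qed

lemma continuous_on_half_circle:
  assumes "continuous_on (sphere 0 1) u"
  shows "continuous_on {-1..1} (\<lambda>x. u (Complex x (sqrt (1 - x\<^sup>2))) * complex_of_real (sqrt (1 - x\<^sup>2) ^ m))"
proof (intro continuous_on_mult continuous_on_compose2[OF assms])
  show "continuous_on {-1..1} (\<lambda>x. Complex x (sqrt (1 - x\<^sup>2)))"
    by (auto intro!: continuous_intros)
  show "(\<lambda>x. Complex x (sqrt (1 - x\<^sup>2))) ` {-1..1} \<subseteq> sphere 0 1"
    by (auto simp: cmod_def abs_square_le_1 abs_le_iff)
qed (auto intro!: continuous_intros)

text \<open>
  The substitution \<open>x = cos t\<close>, whose derivative raises the exponent of the sine by one.
\<close>

lemma half_circle_integral:
  assumes u: "continuous_on (sphere 0 1) u" and p: "2 \<le> p"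
  shows "integral {-1..1} (\<lambda>x. u (Complex x (sqrt (1 - x\<^sup>2))) * complex_of_real (sqrt (1 - x\<^sup>2) ^ (p - 2))) =
    angle_integral (p, v) u"
proof -
  let ?f = "\<lambda>x. u (Complex x (sqrt (1 - x\<^sup>2))) * complex_of_real (sqrt (1 - x\<^sup>2) ^ (p - 2))"
  have "((\<lambda>t. (- sin t) *\<^sub>R ?f (cos t)) has_integral (integral {cos 0..cos pi} ?f - integral {cos pi..cos 0} ?f)) {0..pi}"
  proof (rule has_integral_substitution_general[of "{}" 0 pi cos "-1" 1])
    show "continuous_on {-1..1} ?f" by (rule continuous_on_half_circle[OF u])
  qed (auto intro!: derivative_eq_intros continuous_intros)
  then have "((\<lambda>t. (- sin t) *\<^sub>R ?f (cos t)) has_integral - integral {-1..1} ?f) {0..pi}" by simp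
  from has_integral_neg[OF this]
  have "((\<lambda>t. - ((- sin t) *\<^sub>R ?f (cos t))) has_integral integral {-1..1} ?f) {0..pi}"
    by (simp only: minus_minus)
  moreover have "- ((- sin t) *\<^sub>R ?f (cos t)) = complex_of_real (sin t ^ (p - 1)) * u (cis t)" if "t \<in> {0..pi}" for t
  proof -
    have s: "sqrt (1 - (cos t)\<^sup>2) = sin t"
      using that by (simp add: sin_ge_zero flip: sin_squared_eq)
    have "p - 1 = Suc (p - 2)" using p by simp
    then show ?thesis unfolding s by (simp add: scaleR_conv_of_real cis.ctr mult_ac)
  qed
  ultimately have "((\<lambda>t. complex_of_real (sin t ^ (p - 1)) * u (cis t)) has_integral integral {-1..1} ?f) {0..pi}"
    by (rule has_integral_eq[rotated])
  then show ?thesis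
    using p by (simp add: angle_integral_def angle_bound_def integral_unique)
qed

text \<open>
  The weighted integral over the cube and the torus is a nonzero multiple of the iterated average.
  The constant collects the Gamma factors of the weight and a factor \<open>\<i>\<close> for each
  \<open>dz / z = \<i> dt\<close>.
\<close>

theorem euler_coordinates_integral:
  fixes e :: "nat \<Rightarrow> 'n::finite"
  assumes N: "1 \<le> N" and k: "k = (N - 1) * (N - 2) div 2" and l: "l = N - 1"
  obtains \<kappa> :: complex where "\<kappa> \<noteq> 0"
    "\<And>F. F \<in> matrix_polys \<Longrightarrow>
      (LINT x|cube_measure k. torus_integral l (\<lambda>z. F (euler_product e (euler_word N 0) x z) * complex_of_real (J_SO N x))) =
      \<kappa> * foldr (plane_average e) (euler_planes N) F (mat 1)"
proof -
  have iv: "{0<..0 + (N - 1) * (N - 2) div 2} = {1..k}" using k by auto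
  obtain pl C where pl: "\<And>v. 2 \<le> pl v"
    and word: "\<And>f::nat \<times> nat \<Rightarrow> complex. (\<Prod>i\<leftarrow>euler_word N 0. f i) =
       (\<Prod>j=1..l. f (1, j)) * (\<Prod>v=1..k. f (pl v, v))"
    and C: "C > 0" and "\<And>x. J_SO N (\<lambda>i. x (i + 0)) = C * (\<Prod>v=1..k. sqrt (1 - (x v)\<^sup>2) ^ (pl v - 2))"
    using euler_word_structure[OF N, of 0] unfolding iv unfolding l[symmetric] by blast
  then have J: "J_SO N x = C * (\<Prod>v=1..k. sqrt (1 - (x v)\<^sup>2) ^ (pl v - 2))" for x
    by simp
  \<comment> \<open>The product formula itself shows membership: apply it to the function that vanishes at \<open>i\<close> only.\<close>
  have mem: "i \<in> set (euler_word N 0)"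
    if "i \<in> (\<lambda>j. (1, j)) ` {1..l} \<union> (\<lambda>v. (pl v, v)) ` {1..k}" for i
  proof -
    define f where "f i' = (if i' = i then 0 else 1 :: complex)" for i'
    have "(\<Prod>j=1..l. f (1, j)) * (\<Prod>v=1..k. f (pl v, v)) = 0"
      using that by (auto simp: f_def)
    then have "0 \<in> set (map f (euler_word N 0))"
      unfolding word[symmetric] prod_list_zero_iff .
    then show ?thesis by (auto simp: f_def split: if_splits)
  qed
  have "complex_of_real C * \<i> ^ l \<noteq> 0" using C by simp
  moreover have "(LINT x|cube_measure k. torus_integral l
        (\<lambda>z. F (euler_product e (euler_word N 0) x z) * complex_of_real (J_SO N x))) =
      complex_of_real C * \<i> ^ l * foldr (plane_average e) (euler_planes N) F (mat 1)"
    if F: "F \<in> matrix_polys" for F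
  proof -
    obtain R c u where u: "\<And>r i. r < (R::nat) \<Longrightarrow> i \<in> set (euler_word N 0) \<Longrightarrow> continuous_on (sphere 0 1) (u r i)"
      and Fu: "\<And>x z. F (euler_product e (euler_word N 0) x z) =
        (\<Sum>r<R. c r * (\<Prod>i\<leftarrow>euler_word N 0. u r i (circle_coord x z i)))"
      and Tu: "foldr (plane_average e) (euler_planes N) F (mat 1) =
        (\<Sum>r<R. c r * (\<Prod>i\<leftarrow>euler_word N 0. angle_integral i (u r i)))"
      using euler_product_separable[OF distinct_euler_word F, of N 0 e]
      unfolding separable_along_def map_fst_euler_word by blast
    define hc where "hc x = Complex x (sqrt (1 - x\<^sup>2))" for x
    define g where "g r v x = u r (pl v, v) (hc x) * complex_of_real (sqrt (1 - x\<^sup>2) ^ (pl v - 2))" for r v x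
    have coord: "circle_coord x z (1, j) = z j" "circle_coord x z (pl v, v) = hc (x v)" for x z j v
      using pl[of v] by (auto simp: circle_coord_def hc_def)
    have cont1: "continuous_on (sphere 0 1) (u r (1, j))" if "r < R" "j \<in> {1..l}" for r j
      using that by (intro u mem) auto
    have cont2: "continuous_on (sphere 0 1) (u r (pl v, v))" if "r < R" "v \<in> {1..k}" for r v
      using that by (intro u mem) auto
    have cg: "continuous_on {-1..1} (g r v)" if "r < R" "v \<in> {1..k}" for r v
      unfolding g_def hc_def by (rule continuous_on_half_circle[OF cont2[OF that]])
    have ig: "integral {-1..1} (g r v) = angle_integral (pl v, v) (u r (pl v, v))" if "r < R" "v \<in> {1..k}" for r v
      unfolding g_def hc_def by (rule half_circle_integral[OF cont2[OF that] pl])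
    have ang1: "angle_integral (1, j) h = integral {0..2 * pi} (\<lambda>t. h (cis t))" for j h
      by (simp add: angle_integral_def angle_bound_def)
    have integrand: "F (euler_product e (euler_word N 0) x z) * complex_of_real (J_SO N x) =
        (\<Sum>r<R. (complex_of_real C * c r * (\<Prod>v=1..k. g r v (x v))) * (\<Prod>j=1..l. u r (1, j) (z j)))" for x z
      unfolding Fu word J g_def prod.distrib
      by (simp add: coord sum_distrib_left sum_distrib_right mult_ac del: One_nat_def)
    have inner: "torus_integral l (\<lambda>z. F (euler_product e (euler_word N 0) x z) * complex_of_real (J_SO N x)) =
        (\<Sum>r<R. (complex_of_real C * c r * \<i> ^ l * (\<Prod>j=1..l. angle_integral (1, j) (u r (1, j)))) * (\<Prod>v=1..k. g r v (x v)))" for x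
    proof -
      have "torus_integral l (\<lambda>z. F (euler_product e (euler_word N 0) x z) * complex_of_real (J_SO N x)) =
          (\<Sum>r<R. (complex_of_real C * c r * (\<Prod>v=1..k. g r v (x v))) *
            (\<Prod>j=1..l. \<i> * integral {0..2 * pi} (\<lambda>t. u r (1, j) (cis t))))"
        unfolding integrand by (rule torus_integral_separated) (auto intro: cont1 simp del: One_nat_def)
      then show ?thesis unfolding ang1 prod.distrib by (simp add: mult_ac)
    qed
    have "(LINT x|cube_measure k. torus_integral l
        (\<lambda>z. F (euler_product e (euler_word N 0) x z) * complex_of_real (J_SO N x))) =
      (\<Sum>r<R. (complex_of_real C * c r * \<i> ^ l * (\<Prod>j=1..l. angle_integral (1, j) (u r (1, j)))) *
         (LINT x|cube_measure k. (\<Prod>v=1..k. g r v (x v))))"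
      unfolding inner using cube_integral_prod(1)[OF cg]
      by (subst Bochner_Integration.integral_sum) auto
    also have "\<dots> = (\<Sum>r<R. (complex_of_real C * c r * \<i> ^ l * (\<Prod>j=1..l. angle_integral (1, j) (u r (1, j)))) *
         (\<Prod>v=1..k. angle_integral (pl v, v) (u r (pl v, v))))"
    proof (intro sum.cong refl)
      fix r assume r: "r \<in> {..<R}"
      have "(LINT x|cube_measure k. (\<Prod>v=1..k. g r v (x v))) = (\<Prod>v=1..k. integral {-1..1} (g r v))"
        by (rule cube_integral_prod(2)) (use r cg in auto)
      also have "\<dots> = (\<Prod>v=1..k. angle_integral (pl v, v) (u r (pl v, v)))"
        by (rule prod.cong[OF refl], rule ig) (use r in auto)
      finally show "(complex_of_real C * c r * \<i> ^ l * (\<Prod>j=1..l. angle_integral (1, j) (u r (1, j)))) *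
          (LINT x|cube_measure k. (\<Prod>v=1..k. g r v (x v))) =
        (complex_of_real C * c r * \<i> ^ l * (\<Prod>j=1..l. angle_integral (1, j) (u r (1, j)))) *
          (\<Prod>v=1..k. angle_integral (pl v, v) (u r (pl v, v)))"
        by (rule arg_cong)
    qed
    also have "\<dots> = complex_of_real C * \<i> ^ l * foldr (plane_average e) (euler_planes N) F (mat 1)"
      unfolding Tu word by (simp add: sum_distrib_left mult_ac)
    finally show ?thesis .
  qed
  ultimately show thesis by (rule that)
qed

section \<open>Admissibility in Euler coordinates\<close>

lemma sqrt_polys_sum:
  assumes "\<And>r. r \<in> I \<Longrightarrow> p r \<in> sqrt_polys k"
  shows "(\<lambda>x. \<Sum>r\<in>I. p r x) \<in> sqrt_polys k"
  using assms
  by (induction I rule: infinite_finite_induct) (auto intro: sqrt_polys.intros)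

lemma torus_norm: "z \<in> torus l \<Longrightarrow> i \<in> {1..l} \<Longrightarrow> cmod (z i) = 1"
  by (auto simp: torus_def PiE_iff)

text \<open>
  The exponents of a product are sums of exponents of the factors. Keeping track of this set, and
  not only of the admissibility of the product, is what the final argument rests on.
\<close>

lemma admissible_expansion_mult:
  assumes f: "admissible_expansion k l f S c" and g: "admissible_expansion k l g T d"
  shows "\<exists>c'. admissible_expansion k l (\<lambda>x z. f x z * g x z)
    ((\<lambda>(m, n). \<lambda>i. m i + n i) ` (S \<times> T)) c'"
proof -
  let ?add = "\<lambda>(m, n). \<lambda>i. m i + n i :: int"
  define c' where "c' q x = (\<Sum>p\<in>{p \<in> S \<times> T. ?add p = q}. c (fst p) x * d (snd p) x)" for q x
  have fin: "finite S" "finite T" and sub: "S \<subseteq> multi_indices l" "T \<subseteq> multi_indices l"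
    and cd: "\<And>m. m \<in> S \<Longrightarrow> c m \<in> sqrt_polys k" "\<And>m. m \<in> T \<Longrightarrow> d m \<in> sqrt_polys k"
    using f g by (auto simp: admissible_expansion_def)
  have "admissible_expansion k l (\<lambda>x z. f x z * g x z) (?add ` (S \<times> T)) c'"
    unfolding admissible_expansion_def
  proof (intro conjI ballI)
    show "finite (?add ` (S \<times> T))" using fin by simp
    show "?add ` (S \<times> T) \<subseteq> multi_indices l"
      using sub by (force simp: multi_indices_def)
    show "c' q \<in> sqrt_polys k" for q
      unfolding c'_def[abs_def] using cd by (intro sqrt_polys_sum sqrt_polys.mult) auto
  next
    fix x z assume x: "x \<in> cube k" and z: "z \<in> torus l"
    let ?mon = "\<lambda>m. \<Prod>i=1..l. z i powi m i"
    have nz: "z i \<noteq> 0" if "i \<in> {1..l}" for i using torus_norm[OF z that] by auto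
    have mon: "?mon (?add p) = ?mon (fst p) * ?mon (snd p)" for p
    proof -
      have "?mon (?add p) = (\<Prod>i=1..l. z i powi (fst p i) * z i powi (snd p i))"
        using nz by (intro prod.cong refl) (simp add: case_prod_unfold power_int_add)
      then show ?thesis by (simp add: prod.distrib)
    qed
    have "f x z * g x z = (\<Sum>m\<in>S. c m x * ?mon m) * (\<Sum>n\<in>T. d n x * ?mon n)"
      using f g x z by (simp add: admissible_expansion_def)
    also have "\<dots> = (\<Sum>p\<in>S \<times> T. (c (fst p) x * d (snd p) x) * ?mon (?add p))"
      unfolding mon by (simp add: sum_product sum.cartesian_product case_prod_unfold mult_ac)
    also have "\<dots> = (\<Sum>q\<in>?add ` (S \<times> T). \<Sum>p\<in>{p \<in> S \<times> T. ?add p = q}. (c (fst p) x * d (snd p) x) * ?mon (?add p))"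
      using fin by (intro sum.image_gen) simp
    also have "\<dots> = (\<Sum>q\<in>?add ` (S \<times> T). c' q x * ?mon q)"
      unfolding c'_def sum_distrib_right by (intro sum.cong refl) auto
    finally show "f x z * g x z = (\<Sum>q\<in>?add ` (S \<times> T). c' q x * ?mon q)" .
  qed
  then show ?thesis by blast
qed

lemma admissible_mult:
  "admissible k l f \<Longrightarrow> admissible k l g \<Longrightarrow> admissible k l (\<lambda>x z. f x z * g x z)"
  unfolding admissible_def using admissible_expansion_mult by blast

lemma admissible_add:
  assumes "admissible k l f" "admissible k l g"
  shows "admissible k l (\<lambda>x z. f x z + g x z)"
proof -
  obtain S c T d where f: "admissible_expansion k l f S c" and g: "admissible_expansion k l g T d"
    using assms unfolding admissible_def by blast
  define c' where "c' = (\<lambda>m x. (if m \<in> S then c m x else 0) + (if m \<in> T then d m x else 0))"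
  have "admissible_expansion k l (\<lambda>x z. f x z + g x z) (S \<union> T) c'"
    unfolding admissible_expansion_def
  proof (intro conjI ballI)
    show "finite (S \<union> T)" "S \<union> T \<subseteq> multi_indices l"
      using f g by (auto simp: admissible_expansion_def)
    have "(\<lambda>x. if m \<in> S then c m x else 0) \<in> sqrt_polys k" "(\<lambda>x. if m \<in> T then d m x else 0) \<in> sqrt_polys k" for m
      using f g by (cases "m \<in> S"; cases "m \<in> T"; auto simp: admissible_expansion_def intro: sqrt_polys.const)+
    then show "c' m \<in> sqrt_polys k" for m
      unfolding c'_def by (intro sqrt_polys.add)
    fix x z assume x: "x \<in> cube k" and z: "z \<in> torus l"
    have fin: "finite S" "finite T" using f g by (auto simp: admissible_expansion_def)
    let ?mon = "\<lambda>m. \<Prod>i=1..l. z i powi m i"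
    have "f x z + g x z = (\<Sum>m\<in>S. c m x * ?mon m) + (\<Sum>m\<in>T. d m x * ?mon m)"
      using f g x z by (simp add: admissible_expansion_def)
    also have "(\<Sum>m\<in>S. c m x * ?mon m) = (\<Sum>m\<in>S \<union> T. (if m \<in> S then c m x else 0) * ?mon m)"
      using fin by (intro sum.mono_neutral_cong_left) auto
    also have "(\<Sum>m\<in>T. d m x * ?mon m) = (\<Sum>m\<in>S \<union> T. (if m \<in> T then d m x else 0) * ?mon m)"
      using fin by (intro sum.mono_neutral_cong_left) auto
    finally show "f x z + g x z = (\<Sum>m\<in>S \<union> T. c' m x * ?mon m)"
      by (simp add: c'_def distrib_right sum.distrib)
  qed
  then show ?thesis unfolding admissible_def by blast
qed

lemma admissible_cong:
  assumes "admissible k l f" "\<And>x z. x \<in> cube k \<Longrightarrow> z \<in> torus l \<Longrightarrow> f x z = g x z"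
  shows "admissible k l g"
proof -
  obtain S c where "admissible_expansion k l f S c"
    using assms(1) unfolding admissible_def by blast
  then have "admissible_expansion k l g S c"
    using assms(2) by (simp add: admissible_expansion_def)
  then show ?thesis unfolding admissible_def by blast
qed

lemma admissible_coefficient:
  assumes "p \<in> sqrt_polys k"
  shows "admissible k l (\<lambda>x z. p x)"
  unfolding admissible_def admissible_expansion_def
  using assms by (intro exI[of _ "{\<lambda>_. 0}"] exI[of _ "\<lambda>_. p"]) (auto simp: multi_indices_def)

lemma admissible_monomial:
  assumes "v \<in> {1..l}"
  shows "admissible k l (\<lambda>x z. z v powi m)"
proof -
  define \<mu> where "\<mu> i = (if i = v then m else 0)" for i :: nat
  have "(\<Prod>i=1..l. z i powi \<mu> i) = z v powi m" for z :: "nat \<Rightarrow> complex"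
  proof -
    have "(\<Prod>i=1..l. z i powi \<mu> i) = (\<Prod>i=1..l. if i = v then z v powi m else 1)"
      by (intro prod.cong) (auto simp: \<mu>_def)
    then show ?thesis using assms by simp
  qed
  then have "admissible_expansion k l (\<lambda>x z. z v powi m) {\<mu>} (\<lambda>_ _. 1)"
    using assms by (auto simp: admissible_expansion_def multi_indices_def \<mu>_def intro: sqrt_polys.const)
  then show ?thesis unfolding admissible_def by blast
qed

lemma admissible_const: "admissible k l (\<lambda>x z. a)"
  by (rule admissible_coefficient[OF sqrt_polys.const])

lemma admissible_sum:
  assumes "\<And>r. r \<in> I \<Longrightarrow> admissible k l (f r)"
  shows "admissible k l (\<lambda>x z. \<Sum>r\<in>I. f r x z)"
  using assms
  by (induction I rule: infinite_finite_induct) (auto intro: admissible_add admissible_const)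

text \<open>
  On the torus the complex conjugate of \<open>z\<close> is \<open>z\<inverse>\<close>, so real and imaginary part are Laurent
  polynomials in \<open>z\<close>.
\<close>

lemma admissible_circle_coord:
  assumes "fst i = 1 \<and> snd i \<in> {1..l} \<or> fst i \<noteq> 1 \<and> snd i \<in> {1..k}"
  shows "admissible k l (\<lambda>x z. complex_of_real (Re (circle_coord x z i)))"
    "admissible k l (\<lambda>x z. complex_of_real (Im (circle_coord x z i)))"
proof -
  have "admissible k l (\<lambda>x z. complex_of_real (Re (circle_coord x z i))) \<and>
    admissible k l (\<lambda>x z. complex_of_real (Im (circle_coord x z i)))"
  proof (cases "fst i = 1")
    case True
    then have v: "snd i \<in> {1..l}" using assms by auto
    have inv: "z (snd i) powi (-1) = cnj (z (snd i))" if "z \<in> torus l" for z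
      using torus_norm[OF that v] divide_conv_cnj[of "z (snd i)" 1]
      by (simp add: power_int_minus inverse_eq_divide)
    have "admissible k l (\<lambda>x z. 1 / 2 * (z (snd i) powi 1 + z (snd i) powi (-1)))"
      by (intro admissible_mult admissible_add admissible_const admissible_monomial v)
    then have re: "admissible k l (\<lambda>x z. complex_of_real (Re (circle_coord x z i)))"
    proof (rule admissible_cong)
      fix x z assume z: "z \<in> torus l"
      show "1 / 2 * (z (snd i) powi 1 + z (snd i) powi (-1)) = complex_of_real (Re (circle_coord x z i))"
        unfolding inv[OF z] by (simp add: circle_coord_def True complex_add_cnj)
    qed
    have "admissible k l (\<lambda>x z. - \<i> / 2 * (z (snd i) powi 1 + - 1 * z (snd i) powi (-1)))"
      by (intro admissible_mult admissible_add admissible_const admissible_monomial v)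
    then have "admissible k l (\<lambda>x z. complex_of_real (Im (circle_coord x z i)))"
    proof (rule admissible_cong)
      fix x z assume z: "z \<in> torus l"
      show "- \<i> / 2 * (z (snd i) powi 1 + - 1 * z (snd i) powi (-1)) = complex_of_real (Im (circle_coord x z i))"
        unfolding inv[OF z] by (simp add: circle_coord_def True complex_eq_iff)
    qed
    with re show ?thesis by blast
  next
    case False
    then have v: "snd i \<in> {1..k}" using assms by auto
    then show ?thesis
      using False by (auto simp: circle_coord_def intro!: admissible_coefficient sqrt_polys.intros)
  qed
  then show "admissible k l (\<lambda>x z. complex_of_real (Re (circle_coord x z i)))"
    "admissible k l (\<lambda>x z. complex_of_real (Im (circle_coord x z i)))" by auto
qed

lemma admissible_euler_product:
  fixes e :: "nat \<Rightarrow> 'n::finite"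
  assumes "\<And>i. i \<in> set w \<Longrightarrow> fst i = 1 \<and> snd i \<in> {1..l} \<or> fst i \<noteq> 1 \<and> snd i \<in> {1..k}"
  shows "admissible k l (\<lambda>x z. complex_of_real (euler_product e w x z $ a $ b))"
  using assms
proof (induction w arbitrary: a b)
  case Nil
  then show ?case by (simp add: admissible_const)
next
  case (Cons i w)
  let ?\<zeta> = "\<lambda>x z. circle_coord x z i"
  have \<zeta>: "admissible k l (\<lambda>x z. complex_of_real (Re (?\<zeta> x z)))"
    "admissible k l (\<lambda>x z. complex_of_real (Im (?\<zeta> x z)))"
    "admissible k l (\<lambda>x z. - 1 * complex_of_real (Im (?\<zeta> x z)))"
    using Cons.prems[of i] by (intro admissible_circle_coord admissible_mult[OF admissible_const]; simp)+
  have "admissible k l (\<lambda>x z. complex_of_real (unit_givens e (fst i) (?\<zeta> x z) $ c $ b))" for c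
    using \<zeta> admissible_const[of k l 0] admissible_const[of k l 1]
    by (cases "c = e (fst i)"; cases "c = e (Suc (fst i))"; cases "b = e (fst i)";
        cases "b = e (Suc (fst i))"; cases "c = b") (simp_all add: unit_givens_def givens_def)
  then have "admissible k l (\<lambda>x z. \<Sum>c\<in>UNIV. complex_of_real (euler_product e w x z $ a $ c) *
      complex_of_real (unit_givens e (fst i) (?\<zeta> x z) $ c $ b))"
    using Cons by (intro admissible_sum admissible_mult) auto
  then show ?case by (simp add: matrix_matrix_mult_def)
qed

lemma admissible_matrix_poly:
  fixes e :: "nat \<Rightarrow> 'n::finite" and F :: "real^'n^'n \<Rightarrow> complex"
  assumes "F \<in> matrix_polys"
    and "\<And>i. i \<in> set w \<Longrightarrow> fst i = 1 \<and> snd i \<in> {1..l} \<or> fst i \<noteq> 1 \<and> snd i \<in> {1..k}"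
  shows "admissible k l (\<lambda>x z. F (euler_product e w x z))"
  using assms(1)
proof induction
  case (entry i j)
  show ?case by (rule admissible_euler_product[OF assms(2)])
qed (auto intro: admissible_const admissible_add admissible_mult)

section \<open>Exponents and the vanishing of torus integrals\<close>

lemma circle_power_integral:
  assumes "m \<noteq> 0"
  shows "integral {0..2 * pi} (\<lambda>t. cis t powi m) = 0"
proof -
  let ?f = "\<lambda>t. (cis (real_of_int m * t) - 1) / (\<i> * of_int m)"
  have "integral {0..2 * pi} (\<lambda>t. cis (real_of_int m * t)) = 0"
  proof (rule integral_deriv_zero)
    show "(?f has_vector_derivative cis (real_of_int m * t)) (at t)" for t
    proof -
      have "((\<lambda>w. (exp (\<i> * of_int m * w) - 1) / (\<i> * of_int m)) has_field_derivative
          exp (\<i> * of_int m * complex_of_real t)) (at (complex_of_real t))"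
        using assms by (auto intro!: derivative_eq_intros)
      from has_vector_derivative_real_field[OF this] show ?thesis
        by (simp add: cis_conv_exp mult.assoc)
    qed
    show "?f (2 * pi) = 0"
      using cis_multiple_2pi[of "real_of_int m"] by (simp add: mult.commute)
  qed auto
  then show ?thesis by (simp add: cis_power_int)
qed

text \<open>
  A monomial \<open>z\<^sup>m\<close> with \<open>m\<^sub>j \<noteq> 0\<close> integrates to zero over the \<open>j\<close>-th circle.
\<close>

lemma torus_integral_nonzero_exponents:
  assumes f: "admissible_expansion k l f S c" and S: "(\<lambda>_. 0) \<notin> S" and x: "x \<in> cube k"
  shows "torus_integral l (\<lambda>z. f x z * a) = 0"
proof -
  have fin: "finite S" using f by (simp add: admissible_expansion_def)
  have zero: "(\<Prod>j=1..l. \<i> * integral {0..2 * pi} (\<lambda>t. cis t powi m j)) = 0" if "m \<in> S" for m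
  proof -
    have "m \<noteq> (\<lambda>_. 0)" using that S by auto
    then obtain j where "m j \<noteq> 0" by auto
    moreover have "j \<in> {1..l}"
      using f that \<open>m j \<noteq> 0\<close> by (auto simp: admissible_expansion_def multi_indices_def)
    ultimately show ?thesis
      using circle_power_integral[of "m j"] by (intro prod_zero) auto
  qed
  have "torus_integral l (\<lambda>z. f x z * a) =
      torus_integral l (\<lambda>z. \<Sum>m\<in>S. (c m x * a) * (\<Prod>j=1..l. z j powi m j))"
    using f x by (intro torus_integral_cong) (simp add: admissible_expansion_def sum_distrib_left mult_ac)
  also have "\<dots> = (\<Sum>m\<in>S. (c m x * a) * (\<Prod>j=1..l. \<i> * integral {0..2 * pi} (\<lambda>t. cis t powi m j)))"
    by (rule torus_integral_separated[OF fin]) (auto intro!: continuous_intros)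
  also have "\<dots> = 0" by (intro sum.neutral ballI) (simp only: zero mult_zero_right)
  finally show ?thesis .
qed

text \<open>
  Exponents add under multiplication, and a linear functional adds its values on them.
\<close>

lemma power_mult_exponents:
  fixes a :: "nat \<Rightarrow> real"
  assumes f: "admissible_expansion k l f S c" and h: "admissible_expansion k l h T d"
    and S: "\<And>m. m \<in> S \<Longrightarrow> \<delta> \<le> (\<Sum>i=1..l. a i * real_of_int (m i))"
    and T: "\<And>m. m \<in> T \<Longrightarrow> B \<le> (\<Sum>i=1..l. a i * real_of_int (m i))"
  shows "\<exists>U c'. admissible_expansion k l (\<lambda>x z. f x z ^ P * h x z) U c' \<and>
    (\<forall>m\<in>U. real P * \<delta> + B \<le> (\<Sum>i=1..l. a i * real_of_int (m i)))"
proof (induction P)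
  case 0
  show ?case using h T by auto
next
  case (Suc P)
  then obtain U c' where U: "admissible_expansion k l (\<lambda>x z. f x z ^ P * h x z) U c'"
    "\<And>m. m \<in> U \<Longrightarrow> real P * \<delta> + B \<le> (\<Sum>i=1..l. a i * real_of_int (m i))" by auto
  obtain c'' where c'': "admissible_expansion k l (\<lambda>x z. f x z * (f x z ^ P * h x z))
      ((\<lambda>(m, n). \<lambda>i. m i + n i) ` (S \<times> U)) c''"
    using admissible_expansion_mult[OF f U(1)] by blast
  have "real (Suc P) * \<delta> + B \<le> (\<Sum>i=1..l. a i * real_of_int (m i + n i))" if "m \<in> S" "n \<in> U" for m n
    using S[OF that(1)] U(2)[OF that(2)] by (simp add: distrib_left sum.distrib distrib_right)
  then show ?case using c'' by (intro exI[of _ "(\<lambda>(m, n). \<lambda>i. m i + n i) ` (S \<times> U)"] exI[of _ c''])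
      (auto simp: mult.assoc)
qed

text \<open>
  The separating hyperplane theorem is applied in \<open>\<real>\<^sup>n\<close>, into which the first \<open>l\<close> coordinates are
  embedded through \<open>e\<close>; the embedding is injective on vectors supported in \<open>{1..l}\<close>, so it does not
  move 0 into the convex hull.
\<close>

lemma exponents_in_half_space:
  fixes e :: "nat \<Rightarrow> 'n::finite"
  assumes inj: "inj_on e {1..l}" and fin: "finite S" and sub: "S \<subseteq> multi_indices l"
    and hull: "(\<lambda>_. 0) \<notin> convex hull (real_index ` S)"
  obtains a :: "nat \<Rightarrow> real" and \<delta> where "0 < \<delta>"
    "\<And>m. m \<in> S \<Longrightarrow> \<delta> \<le> (\<Sum>i=1..l. a i * real_of_int (m i))"
proof -
  define L where "L y = (\<chi> i. \<Sum>j\<in>{1..l}. if e j = i then y j else 0)" for y :: "nat \<Rightarrow> real"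
  have comp: "L y $ e j = y j" if "j \<in> {1..l}" for y j
  proof -
    have "L y $ e j = (\<Sum>j'\<in>{1..l}. if j' = j then y j else 0)"
      unfolding L_def using inj_on_eq_iff[OF inj _ that] by (auto intro!: sum.cong)
    then show ?thesis using that by simp
  qed
  have lin: "linear L"
  proof (rule linearI)
    show "L (x + y) = L x + L y" for x y
      by (simp add: L_def vec_eq_iff flip: sum.distrib) (auto intro!: sum.cong)
    show "L (r *\<^sub>R x) = r *\<^sub>R L x" for r x
      by (simp add: L_def vec_eq_iff scaleR_fun_def sum_distrib_left) (auto intro!: sum.cong)
  qed
  have supp: "convex hull (real_index ` S) \<subseteq> {y. \<forall>i. i \<notin> {1..l} \<longrightarrow> y i = 0}"
  proof (rule hull_minimal)
    show "real_index ` S \<subseteq> {y. \<forall>i. i \<notin> {1..l} \<longrightarrow> y i = 0}"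
      using sub by (auto simp: real_index_def multi_indices_def)
    show "convex {y :: nat \<Rightarrow> real. \<forall>i. i \<notin> {1..l} \<longrightarrow> y i = 0}"
      by (rule convexI) (simp add: scaleR_fun_def)
  qed
  have "0 \<notin> convex hull (L ` real_index ` S)"
  proof
    assume "0 \<in> convex hull (L ` real_index ` S)"
    then have "0 \<in> L ` (convex hull (real_index ` S))"
      by (simp add: convex_hull_linear_image[OF lin])
    then obtain y where y: "y \<in> convex hull (real_index ` S)" "L y = 0" by auto
    have "y i = 0" for i
      using supp y(1) comp[of i y] y(2) by (cases "i \<in> {1..l}") auto
    then have "y = (\<lambda>_. 0)" by auto
    then show False using y(1) hull by simp
  qed
  moreover have "compact (convex hull (L ` real_index ` S))"
    using fin by (intro finite_imp_compact_convex_hull) simp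
  ultimately obtain b \<delta> where b: "0 < \<delta>" "\<And>y. y \<in> convex hull (L ` real_index ` S) \<Longrightarrow> b \<bullet> y > \<delta>"
    using separating_hyperplane_closed_0[OF convex_convex_hull compact_imp_closed] by blast
  show thesis
  proof (rule that[OF b(1), of "\<lambda>j. b $ e j"])
    fix m assume m: "m \<in> S"
    have "b \<bullet> L (real_index m) = (\<Sum>j\<in>{1..l}. b $ e j * real_of_int (m j))"
    proof -
      have "b \<bullet> L (real_index m) = (\<Sum>i\<in>UNIV. \<Sum>j\<in>{1..l}. if e j = i then b $ i * real_of_int (m j) else 0)"
        by (simp add: inner_vec_def L_def real_index_def sum_distrib_left if_distrib[of "\<lambda>x. _ * x"] cong: if_cong)
      also have "\<dots> = (\<Sum>j\<in>{1..l}. \<Sum>i\<in>UNIV. if e j = i then b $ i * real_of_int (m j) else 0)"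
        by (rule sum.swap)
      finally show ?thesis by simp
    qed
    moreover have "L (real_index m) \<in> convex hull (L ` real_index ` S)"
      using m by (intro hull_inc) auto
    ultimately show "\<delta> \<le> (\<Sum>i=1..l. b $ e i * real_of_int (m i))"
      using b(2)[of "L (real_index m)"] by simp
  qed
qed

theorem proposition3p6:
  fixes \<mu> :: "(real^'n^'n) measure" and N k l :: nat
  assumes "N = CARD('n)" and "N \<ge> 2"
    and "k = (N - 1) * (N - 2) div 2" and "l = N - 1"
    and haar: "haar_measure_on SO \<mu>"
    and conj: "\<And>f. admissible k l f \<Longrightarrow>
      (\<And>P::nat. P \<ge> 1 \<Longrightarrow>
         (LINT x|cube_measure k.
            torus_integral l (\<lambda>z. f x z ^ P * complex_of_real (J_SO N x))) = 0) \<Longrightarrow>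
      (\<lambda>_. 0) \<notin> convex hull (real_index ` spectrum k l f)"
  shows "\<forall>f h. finite_type SO f \<and> finite_type SO h \<and>
      (\<forall>P::nat. P \<ge> 1 \<longrightarrow> (LINT g|\<mu>. f g ^ P) = 0) \<longrightarrow>
      (\<forall>\<^sub>F P::nat in sequentially. (LINT g|\<mu>. f g ^ P * h g) = 0)"
proof (intro allI impI, elim conjE)
  fix f h :: "real^'n^'n \<Rightarrow> complex"
  assume f: "finite_type SO f" and h: "finite_type SO h"
    and f0: "\<forall>P::nat. P \<ge> 1 \<longrightarrow> (LINT g|\<mu>. f g ^ P) = 0"
  obtain F where F: "F \<in> matrix_polys" "\<And>g. g \<in> SO \<Longrightarrow> f g = F g"
    by (rule finite_type_polynomial[OF haar f]) (rule that)
  obtain H where H: "H \<in> matrix_polys" "\<And>g. g \<in> SO \<Longrightarrow> h g = H g"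
    by (rule finite_type_polynomial[OF haar h]) (rule that)
  obtain e :: "nat \<Rightarrow> 'n" where e: "bij_betw e {1..N} UNIV"
    using ex_bij_betw_nat_finite_1[of "UNIV :: 'n set"] assms(1) by auto
  have inj: "inj_on e {1..l}"
    using bij_betw_imp_inj_on[OF e] assms(4) by (auto elim!: inj_on_subset)
  let ?w = "euler_word N 0"
  have N1: "1 \<le> N" using assms(2) by simp
  obtain \<kappa> where \<kappa>: "\<kappa> \<noteq> 0" "\<And>F. F \<in> matrix_polys \<Longrightarrow>
      (LINT x|cube_measure k. torus_integral l (\<lambda>z. F (euler_product e ?w x z) * complex_of_real (J_SO N x))) =
      \<kappa> * foldr (plane_average e) (euler_planes N) F (mat 1)"
    by (rule euler_coordinates_integral[OF N1 assms(3,4)]) (rule that)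
  have euler: "(LINT x|cube_measure k. torus_integral l (\<lambda>z. F (euler_product e ?w x z) * complex_of_real (J_SO N x))) =
      \<kappa> * (\<Prod>p\<leftarrow>euler_planes N. plane_mass p) * (LINT g|\<mu>. F g)" if "F \<in> matrix_polys" for F
    unfolding \<kappa>(2)[OF that] euler_average_eq_haar[OF e N1 haar that] by (rule mult.assoc[symmetric])
  have range: "fst i = 1 \<and> snd i \<in> {1..l} \<or> fst i \<noteq> 1 \<and> snd i \<in> {1..k}" if "i \<in> set ?w" for i
    using euler_word_mem[of "fst i" "snd i" N 0] that assms(3,4) by auto
  define f' where "f' = (\<lambda>x z. F (euler_product e ?w x z))"
  define h' where "h' = (\<lambda>x z. H (euler_product e ?w x z))"
  have adm: "admissible k l f'" "admissible k l h'"
    unfolding f'_def h'_def by (intro admissible_matrix_poly F(1) H(1) range; assumption)+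
  have hull: "(\<lambda>_. 0) \<notin> convex hull (real_index ` spectrum k l f')"
  proof (rule conj[OF adm(1)])
    fix P :: nat assume "P \<ge> 1"
    have "(LINT g|\<mu>. F g ^ P) = (LINT g|\<mu>. f g ^ P)"
      by (rule Bochner_Integration.integral_cong) (auto simp: haar_space[OF haar] F(2))
    also have "\<dots> = 0" using f0 \<open>P \<ge> 1\<close> by blast
    finally show "(LINT x|cube_measure k. torus_integral l (\<lambda>z. f' x z ^ P * complex_of_real (J_SO N x))) = 0"
      unfolding f'_def using euler[OF matrix_polys_power[OF F(1), of P]] by simp
  qed
  obtain S0 c where S0: "admissible_expansion k l f' S0 c"
    using adm(1) unfolding admissible_def by blast
  obtain T d where T: "admissible_expansion k l h' T d"
    using adm(2) unfolding admissible_def by blast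
  \<comment> \<open>The exponents whose coefficient vanishes on the cube do not belong to the spectrum.\<close>
  define S where "S = {m \<in> S0. \<exists>x\<in>cube k. c m x \<noteq> 0}"
  have S: "admissible_expansion k l f' S c"
    using S0 unfolding admissible_expansion_def S_def
    by (auto intro!: sum.mono_neutral_right)
  have "S \<subseteq> spectrum k l f'" using S0 by (auto simp: S_def spectrum_def)
  then have hull_S: "(\<lambda>_. 0) \<notin> convex hull (real_index ` S)"
    using hull hull_mono[of "real_index ` S" "real_index ` spectrum k l f'" convex] by auto
  have fin_S: "finite S" "S \<subseteq> multi_indices l"
    using S by (auto simp: admissible_expansion_def)
  obtain a \<delta> where a: "0 < \<delta>" "\<And>m. m \<in> S \<Longrightarrow> \<delta> \<le> (\<Sum>i=1..l. a i * real_of_int (m i))"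
    by (rule exponents_in_half_space[OF inj fin_S hull_S]) (rule that)
  have "finite ((\<lambda>m. \<Sum>i=1..l. a i * real_of_int (m i)) ` T)"
    using T by (simp add: admissible_expansion_def)
  then have "bdd_below ((\<lambda>m. \<Sum>i=1..l. a i * real_of_int (m i)) ` T)"
    by (rule bdd_below_finite)
  then obtain B where B: "\<And>m. m \<in> T \<Longrightarrow> B \<le> (\<Sum>i=1..l. a i * real_of_int (m i))"
    unfolding bdd_below_def by auto
  obtain P0 :: nat where P0: "- B < real P0 * \<delta>"
    using reals_Archimedean3[OF a(1)] by auto
  show "\<forall>\<^sub>F P::nat in sequentially. (LINT g|\<mu>. f g ^ P * h g) = 0"
  proof (rule eventually_sequentiallyI)
    fix P assume "P0 \<le> P"
    then have "real P0 * \<delta> \<le> real P * \<delta>" using a(1) by simp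
    then have pos: "0 < real P * \<delta> + B" using P0 by linarith
    obtain U c' where U: "admissible_expansion k l (\<lambda>x z. f' x z ^ P * h' x z) U c'"
      "\<forall>m\<in>U. real P * \<delta> + B \<le> (\<Sum>i=1..l. a i * real_of_int (m i))"
      using power_mult_exponents[OF S T a(2) B] by blast
    have "(\<lambda>_. 0) \<notin> U" using U(2) pos by fastforce
    then have zero: "torus_integral l (\<lambda>z. f' x z ^ P * h' x z * complex_of_real (J_SO N x)) = 0"
      if "x \<in> cube k" for x
      using that by (rule torus_integral_nonzero_exponents[OF U(1)])
    have poly: "(\<lambda>M. F M ^ P * H M) \<in> matrix_polys"
      by (intro matrix_polys.mult matrix_polys_power F(1) H(1))
    have "(LINT x|cube_measure k. torus_integral l (\<lambda>z. f' x z ^ P * h' x z * complex_of_real (J_SO N x))) =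
        (LINT x|cube_measure k. 0)"
      by (rule Bochner_Integration.integral_cong) (simp_all add: space_cube_measure zero)
    then have "\<kappa> * (\<Prod>p\<leftarrow>euler_planes N. plane_mass p) * (LINT g|\<mu>. F g ^ P * H g) = 0"
      using euler[OF poly] by (simp add: f'_def h'_def)
    then have "(LINT g|\<mu>. F g ^ P * H g) = 0"
      using \<kappa>(1) euler_mass_nonzero by simp
    moreover have "(LINT g|\<mu>. f g ^ P * h g) = (LINT g|\<mu>. F g ^ P * H g)"
      by (rule Bochner_Integration.integral_cong) (auto simp: haar_space[OF haar] F(2) H(2))
    ultimately show "(LINT g|\<mu>. f g ^ P * h g) = 0" by simp
  qed
qed

end
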